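(* Let $k,r\ge2$ be integers, let $\Gamma$ be the symmetric graph of type $k$ and order $r$, and put $Q=(r-1)(k-1)$, $\sigma=k-2$. Let $g:\mathbb Z\to\mathbb C$ be an even function. Then the dual Abel transform of $g$ satisfies $$\mathcal A^*g(0)=g(0)$$ and, for all $n>0$, $$\mathcal A^*g(n)=2\,\frac{r-1}{r}\,Q^{-\frac n2}g(n)+\sigma\,\frac{r-1}{r}\,Q^{-\frac{n+1}{2}}\sum_{\substack{-n<j<n\\ j,n\text{ of different parity}}}g(j)+\frac{r-2}{r}\,Q^{-\frac n2}\sum_{\substack{-n<j<n\\ j,n\text{ of the same parity}}}g(j).$$
   Context: Symmetric graph: $\Gamma$ is a connected graph in which every vertex $v$ belongs to exactly $r$ polygons with $k$ sides each (for $k=2$ a polygon is a single edge), these polygons having no side and no vertex in common except $v$, and such that every nontrivial loop runs through all the edges of at least one polygon. $\mathcal V$ is its vertex set. The distance $d(x,y)$ is the minimal number of polygons crossed by a path connecting $x$ with $y$. Fix an origin $o\in\mathcal V$ and put $|x|=d(x,o)$. The sphere $\{x:|x|=n\}$ has cardinality $\delta(n)$, with $\delta(0)=1$ and $\delta(n)=r(k-1)Q^{n-1}$ for $n\ge1$. Boundary: $\Omega$ is the set of geodesic rays starting at $o$; a ray $\omega$ is identified with its sequence of nodes $\omega_0=o,\omega_1,\omega_2,\dots$ in $\mathcal V$, with $d(\omega_i,\omega_j)=|i-j|$. The Busemann function is $\zeta(x,\omega)=d(o,\omega_m)-d(x,\omega_m)$ for $m>|x|$ (independent of such $m$), and the horocycles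 are $H_h(\omega)=\{x\in\mathcal V:\zeta(x,\omega)=h\}$ for $h\in\mathbb Z$. A function on $\mathcal V$ is radial if it depends only on $|x|$; then $f(n)$ is its value at $|x|=n$; $\mathcal D(\mathcal V)^{\sharp}$ is the space of finitely supported radial functions. Abel transform: for $f\in\mathcal D(\mathcal V)^{\sharp}$, $\mathcal Af(h)=Q^{h/2}\sum_{x\in H_h(\omega)}f(x)$, independent of $\omega\in\Omega$ and even in $h\in\mathbb Z$. Dual Abel transform: for an even function $g:\mathbb Z\to\mathbb C$, $\mathcal A^*g$ is the radial function on $\mathcal V$ (identified with a function on $\mathbb N$) defined by $$\sum_{n\in\mathbb N}\mathcal A^*g(n)\,f(n)\,\delta(n)=\sum_{h\in\mathbb Z}g(|h|)\,\mathcal Af(|h|)\qquad\text{for all } f\in\mathcal D(\mathcal V)^{\sharp}.$$ *)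

theory Defs
  imports "HOL-Analysis.Infinite_Sum" "Graph_Theory.Graph_Theory"
begin

text \<open>
  A simple undirected, possibly infinite graph is a \<open>pair_bidirected_digraph\<close>: an edge between
  \<open>u\<close> and \<open>v\<close> is the pair of opposite arcs \<open>(u, v)\<close>, \<open>(v, u)\<close>. The library predicate \<open>cycle\<close>
  is the directed one, so it also holds for the walk \<open>u, v, u\<close>.
\<close>

locale polygon_graph = pair_bidirected_digraph G
  for G :: "'v pair_pre_digraph" and k :: nat
begin

definition sides :: "('v \<times> 'v) list \<Rightarrow> 'v set set" where
  "sides p = (\<lambda>(u, v). {u, v}) ` set p"

text \<open>
  A polygon is recorded as its set of (undirected) sides, so that neither the starting point nor
  the orientation of its boundary matters. For \<open>k = 2\<close> the cycles of length \<open>k\<close> are the walks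
  \<open>u, v, u\<close>, and a polygon is the set consisting of a single edge.
\<close>

definition polygons :: "'v set set set" where
  "polygons = {sides p | p. cycle p \<and> length p = k}"

definition polygons_at :: "'v \<Rightarrow> 'v set set set" where
  "polygons_at v = {P \<in> polygons. v \<in> \<Union>P}"

definition crossed :: "('v \<times> 'v) list \<Rightarrow> 'v set set set" where
  "crossed p = {P \<in> polygons. P \<inter> sides p \<noteq> {}}"

definition d :: "'v \<Rightarrow> 'v \<Rightarrow> nat" where
  "d x y = (INF p \<in> {p. awalk x p y}. card (crossed p))"

end

text \<open>
  A nontrivial loop is a cycle with at least three arcs; backtracking along an edge is trivial.
  In the condition on loops the boundary of a polygon is an oriented cycle \<open>q\<close>. For \<open>k > 2\<close> this
  changes nothing, since both orientations of a polygon are available. For \<open>k = 2\<close> the boundary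
  of an edge is traversed by running through the edge in both directions, which no cycle of length
  at least three does: the condition then says that the graph is a tree, as intended (with
  unoriented sides it would be void). That every edge is a side of some polygon is implicit in
  the notion of a graph made of polygons; it excludes bridges when \<open>k > 2\<close>.
\<close>

locale symmetric_graph = polygon_graph G k
  for G :: "'v pair_pre_digraph" and k :: nat +
  fixes r :: nat
  assumes connected: "Digraph_Component.connected (with_proj G)"
    and edge_in_polygon: "\<And>u v. (u, v) \<in> parcs G \<Longrightarrow> \<exists>P \<in> polygons. {u, v} \<in> P"
    and card_polygons_at: "\<And>v. v \<in> pverts G \<Longrightarrow> card (polygons_at v) = r"
    and polygons_at_disjoint:
      "\<And>v P P'. \<lbrakk>v \<in> pverts G; P \<in> polygons_at v; P' \<in> polygons_at v; P \<noteq> P'\<rbrakk>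
        \<Longrightarrow> P \<inter> P' = {} \<and> \<Union>P \<inter> \<Union>P' = {v}"
    and loop_contains_polygon:
      "\<And>p. \<lbrakk>cycle p; 3 \<le> length p\<rbrakk> \<Longrightarrow> \<exists>q. cycle q \<and> length q = k \<and> set q \<subseteq> set p"

locale rooted_symmetric_graph = symmetric_graph G k r
  for G :: "'v pair_pre_digraph" and k r :: nat +
  fixes v0 :: 'v
  assumes v0_in_verts: "v0 \<in> pverts G"
begin

definition sphere :: "nat \<Rightarrow> 'v set" where
  "sphere n = {x \<in> pverts G. d x v0 = n}"

definition \<delta> :: "nat \<Rightarrow> nat" where
  "\<delta> n = card (sphere n)"

definition \<Omega> :: "(nat \<Rightarrow> 'v) set" where
  "\<Omega> = {\<omega>. range \<omega> \<subseteq> pverts G \<and> \<omega> 0 = v0 \<and>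
           (\<forall>i j. int (d (\<omega> i) (\<omega> j)) = \<bar>int i - int j\<bar>)}"

text \<open>
  Here and in the definition of the Abel transform, the definite description expresses that the
  value does not depend on the choice of \<open>m\<close>, respectively \<open>\<omega>\<close>.
\<close>

definition busemann :: "'v \<Rightarrow> (nat \<Rightarrow> 'v) \<Rightarrow> int" where
  "busemann x \<omega> = (THE h. \<forall>m > d x v0. h = int (d v0 (\<omega> m)) - int (d x (\<omega> m)))"

definition horocycle :: "(nat \<Rightarrow> 'v) \<Rightarrow> int \<Rightarrow> 'v set" where
  "horocycle \<omega> h = {x \<in> pverts G. busemann x \<omega> = h}"

definition radial :: "('v \<Rightarrow> complex) \<Rightarrow> bool" where
  "radial f \<longleftrightarrow> (\<forall>x \<in> pverts G. \<forall>y \<in> pverts G. d x v0 = d y v0 \<longrightarrow> f x = f y)"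

definition radial_value :: "('v \<Rightarrow> complex) \<Rightarrow> nat \<Rightarrow> complex" where
  "radial_value f n = (THE c. \<forall>x \<in> sphere n. f x = c)"

definition radial_fin_supp :: "('v \<Rightarrow> complex) set" where
  "radial_fin_supp = {f. radial f \<and> finite {x \<in> pverts G. f x \<noteq> 0}}"

text \<open>All infinite sums below are applied to finitely supported families.\<close>

definition abel :: "('v \<Rightarrow> complex) \<Rightarrow> int \<Rightarrow> complex" where
  "abel f h = (THE c. \<forall>\<omega> \<in> \<Omega>.
     c = of_real (real ((r - 1) * (k - 1)) powr (real_of_int h / 2)) *
         (\<Sum>\<^sub>\<infinity>x \<in> horocycle \<omega> h. f x))"

text \<open>The dual transform is a radial function, identified with its profile on \<open>nat\<close>.\<close>

definition dual_abel :: "(int \<Rightarrow> complex) \<Rightarrow> nat \<Rightarrow> complex" where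
  "dual_abel g = (THE a. \<forall>f \<in> radial_fin_supp.
     (\<Sum>\<^sub>\<infinity>n. a n * radial_value f n * of_nat (\<delta> n)) =
     (\<Sum>\<^sub>\<infinity>h. g \<bar>h\<bar> * abel f \<bar>h\<bar>))"

end

end

theory Submission
  imports Defs
begin

text \<open>
  A polygon \<open>P\<close> cuts the graph: two of its vertices are not joined by any walk avoiding the sides of
  \<open>P\<close>, since such a walk and an arc of \<open>P\<close> would close up to a loop containing no polygon. Hence every
  vertex \<open>x\<close> has a gate in \<open>P\<close>, and the other vertices of \<open>P\<close> are one step further away from \<open>x\<close>. At
  every vertex other than \<open>x\<close>, exactly one of the polygons leads back to \<open>x\<close>. This determines how the
  distances to the root and to a far node of a ray \<open>\<omega>\<close> change when passing from a sphere to the next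
  one, and yields a recursion for sums of \<open>\<phi> (\<zeta> (x, \<omega>))\<close> over spheres. Solving it gives the number of
  vertices common to a sphere and a horocycle. The dual transform at \<open>n\<close> is the mean over the sphere of
  radius \<open>n\<close> of the weight \<open>g h Q\<^sup>h\<^sup>/\<^sup>2\<close> at \<open>h = \<zeta> (x, \<omega>)\<close>, counted twice for \<open>h > 0\<close> and not at
  all for \<open>h < 0\<close>.
\<close>

section \<open>Walks and polygons\<close>

context pair_bidirected_digraph begin

lemma awalk_verts_ne_conv:
  assumes "awalk u p v" and "p \<noteq> []"
  shows "awalk_verts u p = u # map snd p" and "v = snd (last p)"
proof -
  have "fst (hd p) = u" using assms by (cases p) (auto simp: awalk_Cons_iff)
  moreover have "awalk_verts u p = fst (hd p) # map snd p"
    using awalk_verts_conv'[of u p v] assms by auto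
  ultimately show conv: "awalk_verts u p = u # map snd p" by simp
  have "v = last (awalk_verts u p)" using assms(1) by auto
  then show "v = snd (last p)" using assms(2) by (simp add: conv last_map)
qed

text \<open>The base point of a cycle is the head of its last arc, so every vertex of the cycle is
  the head of one of its arcs.\<close>

lemma cycle_arc_into_tail:
  assumes "cycle q" and "(u, w) \<in> set q"
  shows "\<exists>b. (b, u) \<in> set q"
proof -
  obtain x where x: "awalk x q x" and ne: "q \<noteq> []"
    using assms(1) by (auto simp: cycle_def)
  have "x = snd (last q)" using awalk_verts_ne_conv(2)[OF x ne] .
  then have "x \<in> snd ` set q" using ne by simp
  moreover have "u \<in> set (awalk_verts x q)"
    using awalk_verts_arc1[OF assms(2), of x] by simp
  ultimately have "u \<in> snd ` set q" using awalk_verts_ne_conv(1)[OF x ne] by auto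
  then show ?thesis by force
qed

text \<open>No arc of a path enters its start, whereas a cycle enters each of its vertices. So a
  cycle inside the path cannot use the first arc, and induction applies to the rest.\<close>

lemma no_cycle_within_apath:
  assumes "apath u p v" and "cycle q"
  shows "\<not> set q \<subseteq> set p"
  using assms(1)
proof (induction p arbitrary: u)
  case Nil
  then show ?case using assms(2) by (auto simp: cycle_def)
next
  case (Cons e p)
  obtain a where e: "e = (u, a)" and p: "apath a p v" and u: "u \<notin> set (awalk_verts a p)"
    using Cons.prems by (cases e) (auto simp: apath_Cons_iff)
  show ?case
  proof
    assume sub: "set q \<subseteq> set (e # p)"
    have "e \<notin> set q"
    proof
      assume "e \<in> set q"
      then obtain b where "(b, u) \<in> set q" using cycle_arc_into_tail[OF assms(2)] e by blast
      then have "(b, u) = (u, a) \<or> (b, u) \<in> set p" using sub e by auto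
      moreover have "a \<in> set (awalk_verts a p)" using hd_in_awalk_verts(2)[OF p] by simp
      moreover have "u \<in> set (awalk_verts a p)" if "(b, u) \<in> set p"
        using awalk_verts_arc2[OF awalkI_apath[OF p] that] by simp
      ultimately show False using u by auto
    qed
    then have "set q \<subseteq> set p" using sub by auto
    then show False using Cons.IH[OF p] by simp
  qed
qed

end

context polygon_graph begin

section \<open>Sides, polygons and the polygons crossed by a walk\<close>

lemma sides_Nil [simp]: "sides [] = {}"
  and sides_Cons [simp]: "sides ((u, v) # p) = insert {u, v} (sides p)"
  and sides_append [simp]: "sides (p @ q) = sides p \<union> sides q"
  by (auto simp: sides_def)

lemma sides_rev_path [simp]: "sides (rev_path p) = sides p"
  by (induction p) (auto simp: insert_commute)

lemma sides_mono: "set p \<subseteq> set q \<Longrightarrow> sides p \<subseteq> sides q"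
  by (auto simp: sides_def)

lemma crossed_Nil [simp]: "crossed [] = {}"
  and crossed_append [simp]: "crossed (p @ q) = crossed p \<union> crossed q"
  and crossed_rev_path [simp]: "crossed (rev_path p) = crossed p"
  by (auto simp: crossed_def)

lemma Union_sides:
  assumes "awalk u p v" and "p \<noteq> []"
  shows "\<Union> (sides p) = set (awalk_verts u p)"
proof -
  have "\<Union> (sides p) = (\<Union>e \<in> set p. {fst e, snd e})" by (simp add: sides_def case_prod_beta')
  also have "\<dots> = fst ` set p \<union> snd ` set p" by auto
  finally have "\<Union> (sides p) = fst ` set p \<union> snd ` set p" .
  then show ?thesis using set_awalk_verts_not_Nil[OF assms] by simp
qed

lemma polygonE:
  assumes "P \<in> polygons"
  obtains c u where "cycle c" "length c = k" "sides c = P" "awalk u c u"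
    "distinct (tl (awalk_verts u c))" "c \<noteq> []" "\<Union>P = set (awalk_verts u c)"
proof -
  obtain c where c: "cycle c" "length c = k" "P = sides c"
    using assms by (auto simp: polygons_def)
  then obtain u where "awalk u c u" "distinct (tl (awalk_verts u c))" "c \<noteq> []"
    by (auto simp: cycle_def)
  then show ?thesis using that c Union_sides by metis
qed

text \<open>The base point reappears as the head of the last arc, so the \<open>k\<close> heads list
  all vertices, and they are distinct.\<close>

lemma card_Union_polygon:
  assumes "P \<in> polygons"
  shows "card (\<Union>P) = k"
proof -
  obtain c u where c: "length c = k" "awalk u c u" "distinct (tl (awalk_verts u c))" "c \<noteq> []"
    "\<Union>P = set (awalk_verts u c)"
    using assms by (rule polygonE)
  note conv = awalk_verts_ne_conv[OF c(2,4)]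
  have "u \<in> snd ` set c" using conv(2) c(4) by simp
  then have "set (awalk_verts u c) = set (map snd c)" by (auto simp: conv(1))
  then show ?thesis using c distinct_card[of "map snd c"] by (simp add: conv(1))
qed

lemma finite_Union_polygon: "P \<in> polygons \<Longrightarrow> finite (\<Union>P)"
  by (metis polygonE finite_set)

lemma Union_polygon_subset: "P \<in> polygons \<Longrightarrow> \<Union>P \<subseteq> pverts G"
  by (metis polygonE awalkE')

text \<open>Follow the boundary from \<open>y\<close> to its base point, go on from there to
  \<open>y'\<close>, and shorten the walk to a path.\<close>

lemma polygon_apath:
  assumes "P \<in> polygons" and "y \<in> \<Union>P" and "y' \<in> \<Union>P"
  obtains a where "apath y a y'" "sides a \<subseteq> P"
proof -
  obtain c u where c: "sides c = P" "awalk u c u" "\<Union>P = set (awalk_verts u c)"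
    using assms(1) by (rule polygonE)
  obtain c1 c2 where c12: "c = c1 @ c2" "awalk y c2 u"
    using awalk_decomp[OF c(2), of y] assms c(3) by auto
  obtain d1 d2 where d12: "c = d1 @ d2" "awalk u d1 y'"
    using awalk_decomp[OF c(2), of y'] assms c(3) by auto
  have w: "awalk y (c2 @ d1) y'" using c12(2) d12(2) by (rule awalk_appendI)
  have "set c2 \<subseteq> set c" by (simp add: c12(1))
  moreover have "set d1 \<subseteq> set c" by (simp add: d12(1))
  ultimately have "sides (c2 @ d1) \<subseteq> P" using sides_mono[of "c2 @ d1" c] c(1) by simp
  then have "sides (awalk_to_apath (c2 @ d1)) \<subseteq> P"
    using sides_mono[OF awalk_to_apath_subset[OF w]] by (meson subset_trans)
  then show ?thesis using that[OF apath_awalk_to_apath[OF w]] by simp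
qed

text \<open>The cut point \<open>z\<close> is the tail of the first arc along a side of
  \<open>P\<close>, or \<open>y\<close> if there is no such arc.\<close>

lemma awalk_first_entry:
  assumes "awalk x p y" and "y \<in> \<Union>P"
  obtains p1 p2 z where "p = p1 @ p2" "awalk x p1 z" "awalk z p2 y" "sides p1 \<inter> P = {}" "z \<in> \<Union>P"
  using assms(1)
proof (induction p arbitrary: x thesis)
  case Nil
  then show ?case using assms(2) by (fastforce simp: awalk_Nil_iff)
next
  case (Cons e p)
  obtain a where e: "e = (x, a)" "e \<in> parcs G" and p: "awalk a p y"
    using Cons.prems by (cases e) (auto simp: awalk_Cons_iff)
  show ?case
  proof (cases "{x, a} \<in> P")
    case True
    have "x \<in> \<Union>P" using True by blast
    moreover have "awalk x [] x" using e by (auto simp: awalk_Nil_iff dest: in_arcsD1)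
    ultimately show ?thesis using Cons.prems by (intro Cons.prems(1)[of "[]" "e # p" x]) auto
  next
    case False
    obtain p1 p2 z where "p = p1 @ p2" "awalk a p1 z" "awalk z p2 y" "sides p1 \<inter> P = {}" "z \<in> \<Union>P"
      using Cons.IH[OF _ p] by blast
    then show ?thesis
      using e False by (intro Cons.prems(1)[of "e # p1" p2 z]) (auto simp: awalk_Cons_iff)
  qed
qed

lemma d_le_card_crossed: "awalk x p y \<Longrightarrow> d x y \<le> card (crossed p)"
  unfolding d_def by (rule cINF_lower) auto

lemma d_self [simp]: "x \<in> pverts G \<Longrightarrow> d x x = 0"
  using d_le_card_crossed[of x "[]" x] by (simp add: awalk_Nil_iff)

end

section \<open>Gates and distances\<close>

context symmetric_graph begin

section \<open>Polygons as cut sets\<close>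

lemma exists_awalk:
  assumes "x \<in> pverts G" and "y \<in> pverts G"
  obtains p where "awalk x p y"
proof -
  have "strongly_connected (with_proj G)"
    using symmetric_connected_imp_strongly_connected[OF _ connected] pair_sym_arcs by blast
  then have "x \<rightarrow>\<^sup>*\<^bsub>with_proj G\<^esub> y" using assms by (auto simp: strongly_connected_def)
  then show ?thesis using that by (auto simp: reachable_awalk)
qed

text \<open>An endpoint of a common side lies on both polygons, and distinct polygons at one vertex
  have no side in common.\<close>

lemma polygon_eqI:
  assumes "P \<in> polygons" and "P' \<in> polygons" and "s \<in> P" and "s \<in> P'"
  shows "P = P'"
proof -
  obtain c where c: "P = sides c" "cycle c" using assms(1) by (auto simp: polygons_def)
  then obtain u v where s: "s = {u, v}" "(u, v) \<in> set c" using assms(3) by (auto simp: sides_def)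
  have u: "u \<in> \<Union>P" "u \<in> \<Union>P'" using assms s by blast+
  then have "u \<in> pverts G" using Union_polygon_subset assms by blast
  with u show ?thesis
    using polygons_at_disjoint[of u P P'] assms by (auto simp: polygons_at_def)
qed

text \<open>Otherwise \<open>p\<close> and a path \<open>a\<close> back along \<open>P\<close> close
  up to a cycle, which must contain a polygon. That polygon lies entirely in \<open>p\<close> or
  entirely in \<open>a\<close>, but paths contain no cycles. Induction on the length ensures that
  \<open>p\<close> meets \<open>P\<close> only at its ends.\<close>

lemma apath_avoiding_polygon:
  assumes P: "P \<in> polygons"
    and "apath y p y'" and "sides p \<inter> P = {}" and "y \<in> \<Union>P" and "y' \<in> \<Union>P"
  shows "y = y'"
  using assms(2-)
proof (induction "length p" arbitrary: p y y' rule: less_induct)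
  case less
  show ?case
  proof (rule ccontr)
    assume neq: "y \<noteq> y'"
    have wp: "awalk y p y'" using less.prems by (simp add: apath_def)
    obtain a where a: "apath y' a y" "sides a \<subseteq> P"
      using polygon_apath[OF P less.prems(4) less.prems(3)] by blast
    have wa: "awalk y' a y" using a by (simp add: apath_def)
    \<comment> \<open>An inner vertex of \<open>p\<close> on \<open>P\<close> splits
      \<open>p\<close> into two shorter paths, both trivial by induction.\<close>
    have inner: "z = y \<or> z = y'" if z: "z \<in> set (awalk_verts y p)" "z \<in> \<Union>P" for z
    proof (rule ccontr)
      assume nz: "\<not> (z = y \<or> z = y')"
      obtain q s where qs: "p = q @ s" "awalk y q z" "awalk z s y'"
        using awalk_decomp[OF wp z(1)] by blast
      then have ap: "apath y q z" "apath z s y'"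
        using less.prems(1) by (auto simp: apath_append_iff)
      have "q \<noteq> []" "s \<noteq> []" using nz qs by (auto simp: awalk_Nil_iff)
      then have "length q < length p" "length s < length p" using qs by auto
      then have "y = z" "z = y'"
        using less.hyps[OF _ ap(1)] less.hyps[OF _ ap(2)] less.prems qs(1) z(2) by auto
      then show False using nz by simp
    qed
    have ne: "p \<noteq> []" "a \<noteq> []" using neq wp wa by (auto simp: awalk_Nil_iff)
    have va: "set (awalk_verts y' a) \<subseteq> \<Union>P"
      using Union_sides[OF wa ne(2)] a(2) by blast
    have hd: "awalk_verts y p = y # tl (awalk_verts y p)"
      "awalk_verts y' a = y' # tl (awalk_verts y' a)"
      using wp wa by (metis awhd_of_awalk awalk_verts_non_Nil list.collapse)+
    have dist: "distinct (awalk_verts y p)" "distinct (awalk_verts y' a)"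
      using less.prems(1) a(1) by (auto simp: apath_def)
    have y: "y \<notin> set (tl (awalk_verts y p))" and y': "y' \<notin> set (tl (awalk_verts y' a))"
      using dist hd by (metis distinct.simps(2))+
    have "set (tl (awalk_verts y p)) \<inter> set (tl (awalk_verts y' a)) = {}"
    proof (rule ccontr)
      assume "\<not> ?thesis"
      then obtain z where z: "z \<in> set (tl (awalk_verts y p))" "z \<in> set (tl (awalk_verts y' a))"
        by blast
      then have "z \<in> set (awalk_verts y p)" "z \<in> set (awalk_verts y' a)"
        by (simp_all add: list.set_sel(2))
      then have "z = y \<or> z = y'" using inner va by blast
      then show False using z y y' by auto
    qed
    moreover have "awalk_verts y (p @ a) = awalk_verts y p @ tl (awalk_verts y' a)"
      using awalk_verts_append[of y p a y] wp wa by simp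
    ultimately have "distinct (tl (awalk_verts y (p @ a)))"
      using dist by (simp add: distinct_tl)
    then have cyc: "cycle (p @ a)" using wp wa ne by (auto simp: cycle_def)
    \<comment> \<open>This excludes going along an edge and back, which is a directed cycle: the
      edge would be a side of \<open>P\<close> on \<open>a\<close> and no side of \<open>P\<close>
      on \<open>p\<close>.\<close>
    have "3 \<le> length (p @ a)"
    proof (rule ccontr)
      assume "\<not> 3 \<le> length (p @ a)"
      moreover have "0 < length p" "0 < length a" using ne by simp_all
      ultimately have "length p = 1" "length a = 1" unfolding length_append by linarith+
      then obtain e f where ef: "p = [e]" "a = [f]" by (metis One_nat_def length_0_conv length_Suc_conv)
      then have "p = [(y, y')]" "a = [(y', y)]"
        using wp wa by (cases e, cases f, simp add: awalk_Cons_iff awalk_Nil_iff)+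
      then show False using a(2) less.prems(2) by (auto simp: insert_commute)
    qed
    then obtain q where q: "cycle q" "length q = k" "set q \<subseteq> set (p @ a)"
      using loop_contains_polygon[OF cyc] by blast
    have sq: "sides q \<in> polygons" using q by (auto simp: polygons_def)
    \<comment> \<open>A polygon sharing a side with \<open>P\<close> is \<open>P\<close> itself,
      hence avoids \<open>p\<close>; one sharing no side with \<open>P\<close> avoids
      \<open>a\<close>.\<close>
    show False
    proof (cases "sides q \<inter> P = {}")
      case True
      have "set q \<subseteq> set p" using q(3) True a(2) by (fastforce simp: sides_def)
      then show False using no_cycle_within_apath[OF less.prems(1) q(1)] by simp
    next
      case False
      then have "sides q = P" using polygon_eqI[OF sq P] by blast
      then have "set q \<subseteq> set a" using q(3) less.prems(2) by (fastforce simp: sides_def)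
      then show False using no_cycle_within_apath[OF a(1) q(1)] by simp
    qed
  qed
qed

lemma awalk_avoiding_polygon:
  assumes "P \<in> polygons" and "awalk y p y'" and "sides p \<inter> P = {}" and "y \<in> \<Union>P" and "y' \<in> \<Union>P"
  shows "y = y'"
proof (rule apath_avoiding_polygon[OF assms(1) apath_awalk_to_apath[OF assms(2)] _ assms(4,5)])
  show "sides (awalk_to_apath p) \<inter> P = {}"
    using sides_mono[OF awalk_to_apath_subset[OF assms(2)]] assms(3) by blast
qed

section \<open>Gates of polygons\<close>

text \<open>For a polygon this is its vertex nearest to \<open>x\<close>. The encoding by walks lets
  the cut property give uniqueness before anything is known about distances.\<close>

definition gate :: "'v set set \<Rightarrow> 'v \<Rightarrow> 'v" where
  "gate P x = (THE y. y \<in> \<Union>P \<and> (\<exists>p. awalk x p y \<and> sides p \<inter> P = {}))"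

text \<open>Two such walks from \<open>x\<close> combine to a walk between their ends that avoids
  \<open>P\<close>.\<close>

lemma gate_eqI:
  assumes "P \<in> polygons" and "awalk x p y" and "sides p \<inter> P = {}" and "y \<in> \<Union>P"
  shows "gate P x = y"
  unfolding gate_def
proof (rule the_equality)
  fix z assume z: "z \<in> \<Union>P \<and> (\<exists>p. awalk x p z \<and> sides p \<inter> P = {})"
  then obtain q where q: "awalk x q z" "sides q \<inter> P = {}" by blast
  have "awalk z (rev_path q @ p) y" using q assms(2) by (intro awalk_appendI) simp
  moreover have "sides (rev_path q @ p) \<inter> P = {}" using q(2) assms(3) by auto
  ultimately show "z = y" using awalk_avoiding_polygon[OF assms(1)] assms(4) z by blast
qed (use assms in blast)

lemma gateE:
  assumes "P \<in> polygons" and "x \<in> pverts G"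
  obtains p where "awalk x p (gate P x)" "sides p \<inter> P = {}" "gate P x \<in> \<Union>P"
proof -
  obtain c u where "awalk u c u" "\<Union>P = set (awalk_verts u c)" using assms(1) by (rule polygonE)
  then have u: "u \<in> \<Union>P" "u \<in> pverts G" by (auto simp: hd_in_awalk_verts)
  obtain p where p: "awalk x p u" using exists_awalk[OF assms(2) u(2)] .
  obtain p1 p2 z where "p = p1 @ p2" and p1: "awalk x p1 z" and "awalk z p2 u"
    and p1': "sides p1 \<inter> P = {}" "z \<in> \<Union>P"
    using awalk_first_entry[OF p u(1)] .
  have "gate P x = z" using gate_eqI[OF assms(1) p1 p1'] .
  with p1 p1' show ?thesis by (intro that[of p1]) simp_all
qed

lemma gate_in: "P \<in> polygons \<Longrightarrow> x \<in> pverts G \<Longrightarrow> gate P x \<in> \<Union>P"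
  by (metis gateE)

lemma gate_self:
  assumes "P \<in> polygons" and "x \<in> \<Union>P"
  shows "gate P x = x"
proof -
  have "awalk x [] x" using assms Union_polygon_subset[OF assms(1)] by (auto simp: awalk_Nil_iff)
  then show ?thesis using gate_eqI[OF assms(1), of x "[]" x] assms(2) by simp
qed

section \<open>The distance as a metric, and its relation to gates\<close>

text \<open>A side lies in at most one polygon, so the crossed polygons are an image of the finitely
  many sides.\<close>

lemma finite_crossed: "finite (crossed p)"
proof -
  have "crossed p \<subseteq> (\<lambda>s. THE P. P \<in> polygons \<and> s \<in> P) ` sides p"
  proof
    fix P assume "P \<in> crossed p"
    then obtain s where s: "P \<in> polygons" "s \<in> P" "s \<in> sides p" by (auto simp: crossed_def)
    then have "(THE P. P \<in> polygons \<and> s \<in> P) = P" by (intro the_equality) (auto dest: polygon_eqI)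
    with s show "P \<in> (\<lambda>s. THE P. P \<in> polygons \<and> s \<in> P) ` sides p" by force
  qed
  moreover have "finite (sides p)" by (simp add: sides_def)
  ultimately show ?thesis by (blast intro: finite_surj)
qed

lemma d_attained:
  assumes "x \<in> pverts G" and "y \<in> pverts G"
  obtains p where "awalk x p y" "card (crossed p) = d x y"
proof -
  have "{p. awalk x p y} \<noteq> {}" using exists_awalk[OF assms] by blast
  then have "d x y \<in> (\<lambda>p. card (crossed p)) ` {p. awalk x p y}"
    unfolding d_def by (intro Inf_nat_def1) simp
  then show ?thesis using that by auto
qed

lemma d_commute:
  assumes "x \<in> pverts G" and "y \<in> pverts G"
  shows "d x y = d y x"
proof -
  have "d x y \<le> d y x" if "x \<in> pverts G" "y \<in> pverts G" for x y
  proof -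
    obtain p where "awalk y p x" "card (crossed p) = d y x" using d_attained \<open>y \<in> _\<close> \<open>x \<in> _\<close> by metis
    then show ?thesis using d_le_card_crossed[of x "rev_path p" y] by simp
  qed
  then show ?thesis using assms by (simp add: antisym)
qed

lemma d_triangle:
  assumes "x \<in> pverts G" and "y \<in> pverts G" and "z \<in> pverts G"
  shows "d x z \<le> d x y + d y z"
proof -
  obtain p where p: "awalk x p y" "card (crossed p) = d x y" using d_attained assms by metis
  obtain q where q: "awalk y q z" "card (crossed q) = d y z" using d_attained assms by metis
  have "d x z \<le> card (crossed (p @ q))" using p q by (intro d_le_card_crossed awalk_appendI)
  also have "\<dots> \<le> d x y + d y z" using p q card_Un_le[of "crossed p" "crossed q"] by simp
  finally show ?thesis .
qed

text \<open>The first arc of a nonempty walk is a side of some polygon, so such a walk crosses at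
  least one.\<close>

lemma d_eq_0_iff:
  assumes "x \<in> pverts G" and "y \<in> pverts G"
  shows "d x y = 0 \<longleftrightarrow> x = y"
proof
  assume "d x y = 0"
  then obtain p where p: "awalk x p y" "crossed p = {}"
    using d_attained[OF assms] finite_crossed by (metis card_0_eq)
  show "x = y"
  proof (cases p)
    case Nil
    then show ?thesis using p by (auto simp: awalk_Nil_iff)
  next
    case (Cons e p')
    obtain u v where "e = (u, v)" "(u, v) \<in> parcs G" using Cons p by (cases e) (auto simp: awalk_Cons_iff)
    then show ?thesis using p edge_in_polygon[of u v] Cons by (auto simp: crossed_def)
  qed
qed (use assms in simp)

lemma d_within_polygon:
  assumes "P \<in> polygons" and "y \<in> \<Union>P" and "y' \<in> \<Union>P"
  shows "d y y' \<le> 1"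
proof -
  obtain a where a: "apath y a y'" "sides a \<subseteq> P" using polygon_apath[OF assms] .
  then have "crossed a \<subseteq> {P}" using polygon_eqI[OF _ assms(1)] by (auto simp: crossed_def)
  then have "card (crossed a) \<le> 1" using card_mono[of "{P}"] by simp
  then show ?thesis using d_le_card_crossed[of y a y'] a by (simp add: apath_def)
qed

text \<open>A minimal walk to \<open>y\<close> must use a side of \<open>P\<close>, since otherwise
  \<open>y\<close> would be the gate. Its part before the first such side ends at the gate and
  crosses strictly fewer polygons. The upper bound is the triangle inequality.\<close>

lemma d_gate:
  assumes P: "P \<in> polygons" and x: "x \<in> pverts G" and y: "y \<in> \<Union>P" and neq: "y \<noteq> gate P x"
  shows "d x y = Suc (d x (gate P x))"
proof (rule antisym)
  have yv: "y \<in> pverts G" and gv: "gate P x \<in> pverts G"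
    using y gate_in[OF P x] Union_polygon_subset[OF P] by blast+
  show "d x y \<le> Suc (d x (gate P x))"
    using d_triangle[OF x gv yv] d_within_polygon[OF P gate_in[OF P x] y] by simp
  obtain p where p: "awalk x p y" "card (crossed p) = d x y" using d_attained[OF x yv] .
  obtain p1 p2 z where z: "p = p1 @ p2" "awalk x p1 z" "awalk z p2 y" "sides p1 \<inter> P = {}" "z \<in> \<Union>P"
    using awalk_first_entry[OF p(1) y] .
  have gz: "gate P x = z" using gate_eqI[OF P z(2,4,5)] .
  have "P \<in> crossed p" using gate_eqI[OF P p(1) _ y] neq P by (auto simp: crossed_def)
  moreover have "P \<notin> crossed p1" using z(4) by (auto simp: crossed_def)
  ultimately have "crossed p1 \<subset> crossed p" using z(1) by auto
  then have "card (crossed p1) < d x y" using p(2) finite_crossed psubset_card_mono by metis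
  then show "Suc (d x (gate P x)) \<le> d x y"
    using d_le_card_crossed[OF z(2)] gz by simp
qed

text \<open>After its last side in \<open>P\<close> the path avoids \<open>P\<close> and joins two
  vertices of \<open>P\<close>, so that part is trivial. Conversely, if the gate is
  \<open>v\<close>, the path enters \<open>P\<close> only at its own end and its last arc is no side
  of \<open>P\<close>.\<close>

lemma gate_neq_iff_last_arc:
  assumes ap: "apath x p v" and p: "p = p' @ [(u, v)]" and P: "P \<in> polygons_at v"
  shows "gate P x \<noteq> v \<longleftrightarrow> {u, v} \<in> P"
proof
  have P': "P \<in> polygons" "v \<in> \<Union>P" using P by (auto simp: polygons_at_def)
  have w: "awalk x p v" using ap by (simp add: apath_def)
  {
    assume uv: "{u, v} \<in> P"
    obtain p1 p2 z where z: "p = p1 @ p2" "awalk x p1 z" "awalk z p2 v" "sides p1 \<inter> P = {}" "z \<in> \<Union>P"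
      using awalk_first_entry[OF w P'(2)] by blast
    have gz: "gate P x = z" using gate_eqI[OF P'(1) z(2,4,5)] .
    show "gate P x \<noteq> v"
    proof
      assume "gate P x = v"
      moreover have "apath z p2 v" using ap z by (simp add: apath_append_iff)
      ultimately have "p2 = []" using gz apath_nonempty_ends by blast
      then show False using z(1,4) p uv by auto
    qed
  next
    assume neq: "gate P x \<noteq> v"
    then have "sides p \<inter> P \<noteq> {}" using gate_eqI[OF P'(1) w _ P'(2)] by blast
    then have "\<exists>e \<in> set p. {fst e, snd e} \<in> P" by (fastforce simp: sides_def)
    then obtain ys e zs where e: "p = ys @ e # zs" "{fst e, snd e} \<in> P"
      "\<forall>e' \<in> set zs. {fst e', snd e'} \<notin> P"
      by (auto elim!: split_list_last_propE)
    have zs: "apath (snd e) zs v" using ap e(1) by (auto simp: apath_append_iff apath_Cons_iff)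
    moreover have "sides zs \<inter> P = {}" using e(3) by (auto simp: sides_def split: prod.splits)
    ultimately have "snd e = v"
      using apath_avoiding_polygon[OF P'(1) zs] e(2) P'(2) by blast
    then have "zs = []" using zs apath_nonempty_ends by blast
    then show "{u, v} \<in> P" using e p by auto
  }
qed

text \<open>It is the only polygon with the last arc of a path from \<open>x\<close> to
  \<open>v\<close> as a side.\<close>

lemma ex1_entry_polygon:
  assumes "x \<in> pverts G" and "v \<in> pverts G" and "x \<noteq> v"
  shows "\<exists>!P. P \<in> polygons_at v \<and> gate P x \<noteq> v"
proof -
  obtain q where "awalk x q v" using exists_awalk assms by metis
  then obtain p where ap: "apath x p v" using apath_awalk_to_apath by blast
  then have "p \<noteq> []" using assms(3) by (auto simp: apath_Nil_iff)
  then obtain p' u where p: "p = p' @ [(u, v)]" and uv: "(u, v) \<in> parcs G"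
    using ap by (cases p rule: rev_cases) (auto simp: apath_def awalk_Cons_iff awalk_Nil_iff)
  obtain P where P: "P \<in> polygons" "{u, v} \<in> P" using edge_in_polygon[OF uv] by blast
  then have "P \<in> polygons_at v" by (auto simp: polygons_at_def)
  moreover have "P' = P" if "P' \<in> polygons_at v" "gate P' x \<noteq> v" for P'
    using gate_neq_iff_last_arc[OF ap p that(1)] that polygon_eqI[of P' P "{u, v}"] P
    by (simp add: polygons_at_def)
  ultimately show ?thesis using gate_neq_iff_last_arc[OF ap p] P(2) by blast
qed

section \<open>Child polygons and geodesics\<close>

text \<open>These are the polygons at \<open>x\<close> leading away from \<open>a\<close>, like the
  edges to the children of \<open>x\<close> in a tree with root \<open>a\<close>.\<close>

definition child_polygons :: "'v \<Rightarrow> 'v \<Rightarrow> 'v set set set" where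
  "child_polygons a x = {P \<in> polygons_at x. gate P a = x}"

lemma child_polygonsD:
  assumes "P \<in> child_polygons a x"
  shows "P \<in> polygons" "P \<in> polygons_at x" "x \<in> \<Union>P" "gate P a = x"
  using assms by (auto simp: child_polygons_def polygons_at_def)

text \<open>This is the descent step of inductions on \<open>d a x\<close>: the polygon through
  which \<open>x\<close> is entered from \<open>a\<close> is a child polygon of its gate, one step
  nearer to \<open>a\<close>.\<close>

lemma parent_polygonE:
  assumes "a \<in> pverts G" and "x \<in> pverts G" and "a \<noteq> x"
  obtains P where "P \<in> polygons" "P \<in> polygons_at x" "gate P a \<noteq> x"
    "P \<in> child_polygons a (gate P a)" "gate P a \<in> pverts G" "d a x = Suc (d a (gate P a))"
proof -
  obtain P where P: "P \<in> polygons_at x" "gate P a \<noteq> x"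
    using ex1_entry_polygon[OF assms] by blast
  then have pol: "P \<in> polygons" "x \<in> \<Union>P" by (auto simp: polygons_at_def)
  have "gate P a \<in> \<Union>P" using gate_in[OF pol(1) assms(1)] .
  then have "gate P a \<in> pverts G" "P \<in> child_polygons a (gate P a)"
    using Union_polygon_subset[OF pol(1)] pol(1) by (auto simp: child_polygons_def polygons_at_def)
  then show ?thesis using that P pol(1) d_gate[OF pol(1) assms(1) pol(2)] by metis
qed

lemma entry_polygon_unique:
  assumes "a \<in> pverts G" and "x \<in> pverts G"
    and "P \<in> polygons_at x" and "gate P a \<noteq> x" and "P' \<in> polygons_at x" and "gate P' a \<noteq> x"
  shows "P = P'"
proof -
  have "a \<noteq> x" using assms(3,4) gate_self by (auto simp: polygons_at_def)
  then show ?thesis using ex1_entry_polygon[OF assms(1,2)] assms(3-) by blast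
qed

text \<open>Descend towards \<open>a\<close>. From \<open>w\<close> the vertex \<open>x\<close> is
  entered through \<open>P\<close>, so the polygon \<open>P'\<close> through which it is entered
  from \<open>a\<close> has gate \<open>x\<close> for \<open>w\<close>. Hence the parent
  \<open>x'\<close> is one step further from \<open>w\<close> and one step nearer to
  \<open>a\<close>, and \<open>P'\<close> satisfies the hypotheses at \<open>x'\<close>.\<close>

lemma geodesic_through_child_polygon:
  assumes "a \<in> pverts G" and "w \<in> pverts G" and "x \<in> pverts G"
    and "P \<in> child_polygons a x" and "gate P w \<noteq> x"
  shows "d a x + d x w = d a w"
  using assms(3-)
proof (induction "d a x" arbitrary: x P)
  case 0
  then show ?case using d_eq_0_iff[OF assms(1)] by simp
next
  case (Suc n)
  then have "a \<noteq> x" by auto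
  then obtain P' where P': "P' \<in> polygons" "P' \<in> polygons_at x" "gate P' a \<noteq> x"
    "P' \<in> child_polygons a (gate P' a)" "gate P' a \<in> pverts G" "d a x = Suc (d a (gate P' a))"
    using parent_polygonE[OF assms(1) Suc.prems(1)] by blast
  define x' where "x' = gate P' a"
  note P = child_polygonsD[OF Suc.prems(2)]
  have g: "gate P' w = x"
  proof (rule ccontr)
    assume "gate P' w \<noteq> x"
    then have "P = P'" using entry_polygon_unique[OF assms(2) Suc.prems(1)] P(2) P'(2) Suc.prems(3) by blast
    then show False using P(4) P'(3) by simp
  qed
  have "d a x' + d x' w = d a w"
    using Suc.hyps P' g unfolding x'_def by (intro Suc.hyps(1)[of _ P']) auto
  moreover have "d w x' = Suc (d w x)"
    using d_gate[OF P'(1) assms(2), of x'] g P'(3,4) child_polygonsD(3) x'_def by metis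
  ultimately show ?case
    using P'(5,6) d_commute[OF assms(2)] Suc.prems(1) unfolding x'_def by simp
qed

text \<open>Otherwise the gate of \<open>P\<close> for \<open>w\<close> is a shortcut: nearer to
  \<open>w\<close> than \<open>x\<close> and no further from \<open>a\<close>.\<close>

lemma child_polygon_of_geodesic:
  assumes a: "a \<in> pverts G" and w: "w \<in> pverts G" and x: "x \<in> pverts G"
    and geo: "d a x + d x w = d a w" and P: "P \<in> polygons_at x" "gate P w \<noteq> x"
  shows "P \<in> child_polygons a x"
proof (rule ccontr)
  assume "P \<notin> child_polygons a x"
  then have g: "gate P a \<noteq> x" using P by (simp add: child_polygons_def)
  have pol: "P \<in> polygons" "x \<in> \<Union>P" using P by (auto simp: polygons_at_def)
  let ?y = "gate P w"
  have y: "?y \<in> \<Union>P" "?y \<in> pverts G"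
    using gate_in[OF pol(1) w] Union_polygon_subset[OF pol(1)] by auto
  have "d a ?y \<le> d a x"
    using d_gate[OF pol(1) a pol(2)] d_gate[OF pol(1) a y(1)] g by (cases "?y = gate P a") auto
  moreover have "d w x = Suc (d w ?y)" using d_gate[OF pol(1) w pol(2)] P(2) by simp
  moreover have "d a w \<le> d a ?y + d ?y w" using d_triangle a w y(2) by blast
  ultimately show False using geo d_commute[OF w x] d_commute[OF w y(2)] by simp
qed

text \<open>By induction \<open>x\<close> and \<open>y\<close> have the same parent. From
  \<open>w\<close> this parent is entered through one polygon only, and both \<open>x\<close> and
  \<open>y\<close> are the gate of that polygon for \<open>w\<close>.\<close>

lemma geodesic_vertex_unique:
  assumes a: "a \<in> pverts G" and w: "w \<in> pverts G"
    and "x \<in> pverts G" and "d a x + d x w = d a w"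
    and "y \<in> pverts G" and "d a y + d y w = d a w" and "d a x = d a y"
  shows "x = y"
  using assms(3-)
proof (induction "d a x" arbitrary: x y)
  case 0
  then show ?case using d_eq_0_iff[OF a] by metis
next
  case (Suc n)
  \<comment> \<open>The polygon through which \<open>z\<close> is entered from \<open>a\<close> has
    gate \<open>z\<close> for \<open>w\<close>, and its gate for \<open>a\<close> is again on the
    geodesic.\<close>
  have parent: "\<exists>P. P \<in> polygons \<and> P \<in> polygons_at (gate P a) \<and> gate P a \<in> pverts G \<and> gate P w = z
      \<and> gate P a \<noteq> z \<and> d a (gate P a) = n \<and> d a (gate P a) + d (gate P a) w = d a w"
    if z: "z \<in> pverts G" "d a z + d z w = d a w" "d a z = Suc n" for z
  proof -
    have "a \<noteq> z" using z(3) a by auto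
    then obtain P where P: "P \<in> polygons" "P \<in> polygons_at z" "gate P a \<noteq> z"
      "P \<in> child_polygons a (gate P a)" "gate P a \<in> pverts G" "d a z = Suc (d a (gate P a))"
      using parent_polygonE[OF a z(1)] by blast
    have g: "gate P w = z"
      using child_polygon_of_geodesic[OF a w z(1,2) P(2)] child_polygonsD(4)[of P a z] P(3) by blast
    have "d w (gate P a) = Suc (d w z)"
      using d_gate[OF P(1) w child_polygonsD(3)[OF P(4)]] g P(3) by simp
    then show ?thesis
      using P g z child_polygonsD(2)[OF P(4)] d_commute[OF w z(1)] d_commute[OF w P(5)]
      by (intro exI[of _ P]) simp
  qed
  obtain P where P: "P \<in> polygons_at (gate P a)" "gate P a \<in> pverts G" "gate P w = x"
      "gate P a \<noteq> x" "d a (gate P a) = n" "d a (gate P a) + d (gate P a) w = d a w"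
    using parent[OF Suc.prems(1,2) Suc.hyps(2)[symmetric]] by metis
  obtain P' where P': "P' \<in> polygons_at (gate P' a)" "gate P' a \<in> pverts G" "gate P' w = y"
      "gate P' a \<noteq> y" "d a (gate P' a) = n" "d a (gate P' a) + d (gate P' a) w = d a w"
    using parent[OF Suc.prems(3,4) trans[OF Suc.prems(5)[symmetric] Suc.hyps(2)[symmetric]]] by metis
  have eq: "gate P a = gate P' a"
    using Suc.hyps(1)[OF P(5)[symmetric] P(2,6) P'(2,6)] P(5) P'(5) by simp
  have "P = P'"
    using entry_polygon_unique[OF w P(2,1)] P(3,4) P'(1,3,4) unfolding eq by simp
  then show ?case using P(3) P'(3) by simp
qed

end

section \<open>Spheres and rays\<close>

locale branching_rooted_symmetric_graph = rooted_symmetric_graph G k r v0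
  for G :: "'v pair_pre_digraph" and k r :: nat and v0 :: 'v +
  assumes k_ge_2: "2 \<le> k" and r_ge_2: "2 \<le> r"
begin

definition Q :: nat where
  "Q = (r - 1) * (k - 1)"

text \<open>This splits the children of a non-root vertex into those in one chosen child polygon and
  those in the other \<open>r - 2\<close>.\<close>

lemma Q_eq: "Q = (r - 2) * (k - 1) + (k - 1)"
proof -
  have "r - 1 = Suc (r - 2)" using r_ge_2 by simp
  then show ?thesis by (simp add: Q_def)
qed

lemma Q_pos: "0 < Q"
  using k_ge_2 r_ge_2 by (simp add: Q_def)

text \<open>Infinite sets have \<open>card\<close> 0, so a positive cardinality gives
  finiteness.\<close>

lemma finite_polygons_at: "x \<in> pverts G \<Longrightarrow> finite (polygons_at x)"
  using card_polygons_at[of x] r_ge_2 by (intro card_ge_0_finite) simp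

lemma finite_child_polygons: "x \<in> pverts G \<Longrightarrow> finite (child_polygons v0 x)"
  using finite_polygons_at[of x] by (auto simp: child_polygons_def)

text \<open>At the root every polygon leads away; elsewhere exactly one polygon leads back.\<close>

lemma card_child_polygons:
  assumes "x \<in> pverts G"
  shows "card (child_polygons v0 x) = (if x = v0 then r else r - 1)"
proof (cases "x = v0")
  case True
  have "child_polygons v0 v0 = polygons_at v0"
    using gate_self by (auto simp: child_polygons_def polygons_at_def)
  then show ?thesis using True card_polygons_at[OF assms] by simp
next
  case False
  then obtain P where P: "P \<in> polygons_at x" "gate P v0 \<noteq> x"
    using ex1_entry_polygon[OF v0_in_verts assms] by auto
  have "gate P' v0 = x" if "P' \<in> polygons_at x" "P' \<noteq> P" for P'
    using entry_polygon_unique[OF v0_in_verts assms P that(1)] that(2) by blast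
  then have "child_polygons v0 x = polygons_at x - {P}"
    using P by (auto simp: child_polygons_def)
  then show ?thesis using False P(1) card_polygons_at[OF assms] by simp
qed

section \<open>Spheres and their cardinalities\<close>

lemma sphereD:
  assumes "x \<in> sphere n"
  shows "x \<in> pverts G" "d v0 x = n"
  using assms d_commute[of x v0] v0_in_verts by (simp_all add: sphere_def)

lemma sphereI: "x \<in> pverts G \<Longrightarrow> d v0 x = n \<Longrightarrow> x \<in> sphere n"
  using d_commute[of x v0] v0_in_verts by (simp add: sphere_def)

lemma sphere_0: "sphere 0 = {v0}"
  using d_eq_0_iff[OF v0_in_verts] v0_in_verts by (auto dest: sphereD intro: sphereI)

lemma child_in_sphere:
  assumes "x \<in> sphere n" and "P \<in> child_polygons v0 x" and "y \<in> \<Union>P - {x}"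
  shows "y \<in> sphere (Suc n)" "gate P v0 = x" "P \<in> polygons_at y" "gate P v0 \<noteq> y"
proof -
  note P = child_polygonsD[OF assms(2)]
  have "y \<in> pverts G" using Union_polygon_subset[OF P(1)] assms(3) by blast
  then show "y \<in> sphere (Suc n)"
    using d_gate[OF P(1) v0_in_verts, of y] P(4) assms(1,3) by (intro sphereI) (auto dest: sphereD)
  show "gate P v0 = x" "P \<in> polygons_at y" "gate P v0 \<noteq> y"
    using P assms(3) by (auto simp: polygons_at_def)
qed

text \<open>A vertex \<open>y\<close> of the next sphere determines the polygon \<open>P\<close>
  through which it is entered from the root, and its parent \<open>x\<close> is the gate of
  \<open>P\<close>.\<close>

lemma bij_betw_children:
  "bij_betw (\<lambda>(x, P, y). y)
    (SIGMA x:sphere n. SIGMA P:child_polygons v0 x. \<Union>P - {x}) (sphere (Suc n))"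
proof (rule bij_betwI')
  fix s t
  assume s: "s \<in> (SIGMA x:sphere n. SIGMA P:child_polygons v0 x. \<Union>P - {x})"
    and t: "t \<in> (SIGMA x:sphere n. SIGMA P:child_polygons v0 x. \<Union>P - {x})"
  obtain x P y where s': "s = (x, P, y)" "x \<in> sphere n" "P \<in> child_polygons v0 x" "y \<in> \<Union>P - {x}"
    using s by (cases s) auto
  obtain x' P' y' where t': "t = (x', P', y')" "x' \<in> sphere n" "P' \<in> child_polygons v0 x'" "y' \<in> \<Union>P' - {x'}"
    using t by (cases t) auto
  note cs = child_in_sphere[OF s'(2-)] and ct = child_in_sphere[OF t'(2-)]
  have "P = P'" if "y = y'"
    using entry_polygon_unique[OF v0_in_verts sphereD(1)[OF cs(1)] cs(3,4)] ct(3,4) that by simp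
  then show "((\<lambda>(x, P, y). y) s = (\<lambda>(x, P, y). y) t) = (s = t)"
    using s'(1) t'(1) cs(2) ct(2) by auto
next
  fix s
  assume "s \<in> (SIGMA x:sphere n. SIGMA P:child_polygons v0 x. \<Union>P - {x})"
  then show "(\<lambda>(x, P, y). y) s \<in> sphere (Suc n)" using child_in_sphere(1) by fastforce
next
  fix y
  assume y: "y \<in> sphere (Suc n)"
  note yv = sphereD[OF y]
  have "v0 \<noteq> y" using yv v0_in_verts by auto
  then obtain P where P: "P \<in> polygons" "P \<in> polygons_at y" "gate P v0 \<noteq> y"
    "P \<in> child_polygons v0 (gate P v0)" "gate P v0 \<in> pverts G" "d v0 y = Suc (d v0 (gate P v0))"
    using parent_polygonE[OF v0_in_verts yv(1)] by blast
  have "gate P v0 \<in> sphere n" using P(5,6) yv(2) by (intro sphereI) auto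
  then have "(gate P v0, P, y) \<in> (SIGMA x:sphere n. SIGMA P:child_polygons v0 x. \<Union>P - {x})"
    using P(2,3,4) by (auto simp: polygons_at_def)
  then show "\<exists>s \<in> (SIGMA x:sphere n. SIGMA P:child_polygons v0 x. \<Union>P - {x}). y = (\<lambda>(x, P, y). y) s"
    by force
qed

lemma finite_sphere: "finite (sphere n)"
proof (induction n)
  case 0
  then show ?case by (simp add: sphere_0)
next
  case (Suc n)
  have "finite (SIGMA x:sphere n. SIGMA P:child_polygons v0 x. \<Union>P - {x})"
    using Suc finite_child_polygons finite_Union_polygon child_polygonsD(1)
    by (intro finite_SigmaI finite_Diff) (auto dest: sphereD)
  then show ?case using bij_betw_finite[OF bij_betw_children] by blast
qed

lemma sum_sphere_Suc:
  "(\<Sum>y \<in> sphere (Suc n). f y) = (\<Sum>x \<in> sphere n. \<Sum>P \<in> child_polygons v0 x. \<Sum>y \<in> \<Union>P - {x}. f y)"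
proof -
  have fin: "finite (child_polygons v0 x)" "\<forall>P \<in> child_polygons v0 x. finite (\<Union>P - {x})"
    if "x \<in> sphere n" for x
    using that finite_child_polygons finite_Union_polygon child_polygonsD(1) by (blast dest: sphereD)+
  have "(\<Sum>y \<in> sphere (Suc n). f y)
      = (\<Sum>s \<in> (SIGMA x:sphere n. SIGMA P:child_polygons v0 x. \<Union>P - {x}). f ((\<lambda>(x, P, y). y) s))"
    by (rule sum.reindex_bij_betw[OF bij_betw_children, symmetric])
  also have "\<dots> = (\<Sum>x \<in> sphere n. \<Sum>t \<in> (SIGMA P:child_polygons v0 x. \<Union>P - {x}). f (snd t))"
    using fin finite_sphere by (subst sum.Sigma) (auto simp: case_prod_beta')
  also have "\<dots> = (\<Sum>x \<in> sphere n. \<Sum>P \<in> child_polygons v0 x. \<Sum>y \<in> \<Union>P - {x}. f y)"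
    using fin by (intro sum.cong refl) (subst sum.Sigma, auto simp: case_prod_beta')
  finally show ?thesis .
qed

lemma card_polygon_minus:
  assumes "P \<in> child_polygons v0 x"
  shows "card (\<Union>P - {x}) = k - 1"
  using child_polygonsD(1,3)[OF assms] card_Union_polygon[of P] finite_Union_polygon[of P] by simp

lemma \<delta>_0: "\<delta> 0 = 1"
  by (simp add: \<delta>_def sphere_0)

lemma \<delta>_Suc: "\<delta> (Suc n) = r * (k - 1) * Q ^ n"
proof (induction n)
  case 0
  have "\<delta> (Suc 0) = (\<Sum>P \<in> child_polygons v0 v0. \<Sum>y \<in> \<Union>P - {v0}. 1)"
    using sum_sphere_Suc[of "\<lambda>_. 1::nat" 0] by (simp add: \<delta>_def sphere_0)
  also have "\<dots> = (\<Sum>P \<in> child_polygons v0 v0. k - 1)"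
    using card_polygon_minus by (intro sum.cong) auto
  finally show ?case using card_child_polygons[OF v0_in_verts] by simp
next
  case (Suc n)
  have "\<delta> (Suc (Suc n)) = (\<Sum>x \<in> sphere (Suc n). \<Sum>P \<in> child_polygons v0 x. \<Sum>y \<in> \<Union>P - {x}. 1)"
    using sum_sphere_Suc[of "\<lambda>_. 1::nat" "Suc n"] by (simp add: \<delta>_def)
  also have "\<dots> = (\<Sum>x \<in> sphere (Suc n). \<Sum>P \<in> child_polygons v0 x. k - 1)"
    using card_polygon_minus by (intro sum.cong) auto
  also have "\<dots> = (\<Sum>x \<in> sphere (Suc n). Q)"
  proof (intro sum.cong refl)
    fix x assume x: "x \<in> sphere (Suc n)"
    then have "x \<noteq> v0" using sphereD(2)[OF x] v0_in_verts by auto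
    then show "(\<Sum>P \<in> child_polygons v0 x. k - 1) = Q"
      using card_child_polygons[OF sphereD(1)[OF x]] by (simp add: Q_def)
  qed
  finally show ?case using Suc by (simp add: \<delta>_def)
qed

lemma \<delta>_pos: "0 < \<delta> n"
  using Q_pos k_ge_2 r_ge_2 by (cases n) (simp_all add: \<delta>_0 \<delta>_Suc)

section \<open>Rays and the Busemann function\<close>

text \<open>Choose children one after another. Unit steps bound the distance of two nodes from
  above, and the difference of their levels bounds it from below.\<close>

lemma \<Omega>_nonempty: "\<Omega> \<noteq> {}"
proof -
  have "\<exists>y. y \<in> sphere (Suc n) \<and> d x y = 1" if x: "x \<in> sphere n" for x n
  proof -
    have "0 < card (child_polygons v0 x)"
      using card_child_polygons[OF sphereD(1)[OF x]] r_ge_2 by simp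
    then obtain P where P: "P \<in> child_polygons v0 x" by (metis card_gt_0_iff ex_in_conv)
    have "0 < card (\<Union>P - {x})" using card_polygon_minus[OF P] k_ge_2 by simp
    then obtain y where y: "y \<in> \<Union>P - {x}" by (metis card_gt_0_iff ex_in_conv)
    note P' = child_polygonsD[OF P]
    have "d x y = 1"
      using d_gate[OF P'(1) sphereD(1)[OF x], of y] gate_self[OF P'(1,3)] y sphereD(1)[OF x] by simp
    then show ?thesis using child_in_sphere(1)[OF x P y] by blast
  qed
  moreover have "v0 \<in> sphere 0" by (simp add: sphere_0)
  ultimately obtain \<omega> where \<omega>: "\<omega> 0 = v0" "\<And>n. \<omega> n \<in> sphere n" "\<And>n. d (\<omega> n) (\<omega> (Suc n)) = 1"
    using dependent_nat_choice[of "\<lambda>n x. x \<in> sphere n \<and> (n = 0 \<longrightarrow> x = v0)" "\<lambda>n x y. d x y = 1"]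
    by (metis nat.distinct(1))
  have v: "\<omega> n \<in> pverts G" "d v0 (\<omega> n) = n" for n using sphereD[OF \<omega>(2)] by auto
  have le: "d (\<omega> i) (\<omega> (i + n)) \<le> n" for i n
  proof (induction n)
    case (Suc n)
    then show ?case using d_triangle[OF v(1)[of i] v(1)[of "i + n"] v(1)[of "i + Suc n"]] \<omega>(3)[of "i + n"] by simp
  qed (use v in simp)
  have "int (d (\<omega> i) (\<omega> j)) = \<bar>int i - int j\<bar>" if "i \<le> j" for i j
    using le[of i "j - i"] that d_triangle[OF v0_in_verts v(1)[of i] v(1)[of j]] v(2) by simp
  then have "int (d (\<omega> i) (\<omega> j)) = \<bar>int i - int j\<bar>" for i j
    using d_commute[OF v(1)[of i] v(1)[of j]] nat_le_linear[of i j] by (metis abs_minus_commute)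
  then have "\<omega> \<in> \<Omega>" using \<omega>(1) v(1) by (auto simp: \<Omega>_def)
  then show ?thesis by blast
qed

lemma \<Omega>D:
  assumes "\<omega> \<in> \<Omega>"
  shows "\<omega> n \<in> pverts G" "d v0 (\<omega> n) = n" "\<omega> n \<in> sphere n"
    "n \<le> m \<Longrightarrow> d (\<omega> n) (\<omega> m) = m - n"
proof -
  have *: "int (d (\<omega> i) (\<omega> j)) = \<bar>int i - int j\<bar>" for i j using assms by (simp add: \<Omega>_def)
  show v: "\<omega> n \<in> pverts G" and "d v0 (\<omega> n) = n"
    using assms *[of 0 n] by (auto simp: \<Omega>_def)
  then show "\<omega> n \<in> sphere n" by (rule sphereI)
  show "n \<le> m \<Longrightarrow> d (\<omega> n) (\<omega> m) = m - n" using *[of n m] by simp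
qed

text \<open>The polygon \<open>P\<close> through \<open>?u\<close> and \<open>?y\<close> is a child
  polygon of \<open>?u\<close>. If its gate for \<open>x\<close> were not \<open>?u\<close>, then
  \<open>?u\<close> would lie on a geodesic from the root to \<open>x\<close>, although its level
  \<open>m\<close> exceeds that of \<open>x\<close>.\<close>

lemma d_ray_Suc:
  assumes \<omega>: "\<omega> \<in> \<Omega>" and x: "x \<in> pverts G" and m: "d v0 x < m"
  shows "d x (\<omega> (Suc m)) = Suc (d x (\<omega> m))"
proof -
  let ?u = "\<omega> m" and ?y = "\<omega> (Suc m)"
  note u = \<Omega>D(1-3)[OF \<omega>, of m] and y = \<Omega>D(1-3)[OF \<omega>, of "Suc m"]
  have uy: "d ?u ?y = 1" using \<Omega>D(4)[OF \<omega>, of m "Suc m"] by simp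
  then have "?u \<noteq> ?y" using u by auto
  then obtain P where P: "P \<in> polygons" "P \<in> polygons_at ?y" "gate P ?u \<noteq> ?y"
    "P \<in> child_polygons ?u (gate P ?u)" "gate P ?u \<in> pverts G" "d ?u ?y = Suc (d ?u (gate P ?u))"
    using parent_polygonE[OF u(1) y(1)] by blast
  have "gate P ?u = ?u" using P(5,6) uy d_eq_0_iff[OF u(1) P(5)] by simp
  then have uP: "?u \<in> \<Union>P" "?y \<in> \<Union>P" "P \<in> polygons_at ?u"
    using P child_polygonsD[OF P(4)] by (auto simp: polygons_at_def)
  \<comment> \<open>Otherwise the gate has level \<open>m - 1\<close> and no vertex of
    \<open>P\<close> has a level above \<open>m\<close>, contrary to \<open>?y\<close>.\<close>
  have "gate P v0 = ?u"
  proof (rule ccontr)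
    assume "gate P v0 \<noteq> ?u"
    then have "m = Suc (d v0 (gate P v0))" using d_gate[OF P(1) v0_in_verts uP(1)] u(2) by simp
    then show False using d_gate[OF P(1) v0_in_verts uP(2)] y(2) by (cases "gate P v0 = ?y") auto
  qed
  then have "P \<in> child_polygons v0 ?u" using uP(3) by (simp add: child_polygons_def)
  then have "gate P x = ?u"
    using geodesic_through_child_polygon[OF v0_in_verts x u(1)] u(2) m by fastforce
  then show ?thesis using d_gate[OF P(1) x uP(2)] \<open>?u \<noteq> ?y\<close> by simp
qed

text \<open>Beyond the level of \<open>x\<close>, both distances grow by one at each step along the
  ray, so the difference is constant and the definite description is justified.\<close>

lemma busemann_eq:
  assumes \<omega>: "\<omega> \<in> \<Omega>" and x: "x \<in> pverts G" and m: "d v0 x < m"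
  shows "busemann x \<omega> = int m - int (d x (\<omega> m))"
proof -
  have v: "d x v0 = d v0 x" using d_commute[OF x v0_in_verts] .
  have "int (Suc (d v0 x) + i) - int (d x (\<omega> (Suc (d v0 x) + i)))
      = int (Suc (d v0 x)) - int (d x (\<omega> (Suc (d v0 x))))" for i
    by (induction i) (use d_ray_Suc[OF \<omega> x] in auto)
  then have *: "int l - int (d x (\<omega> l)) = int (Suc (d v0 x)) - int (d x (\<omega> (Suc (d v0 x))))"
    if "d v0 x < l" for l
    using that by (metis Suc_leI le_add_diff_inverse)
  have "busemann x \<omega> = int (Suc (d v0 x)) - int (d x (\<omega> (Suc (d v0 x))))"
    unfolding busemann_def v using * \<Omega>D(2)[OF \<omega>] by (intro the_equality) auto
  then show ?thesis using *[OF m] by simp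
qed

lemma abs_busemann_le:
  assumes \<omega>: "\<omega> \<in> \<Omega>" and x: "x \<in> sphere n"
  shows "\<bar>busemann x \<omega>\<bar> \<le> int n"
proof -
  note xv = sphereD[OF x] and w = \<Omega>D(1,2)[OF \<omega>, of "Suc n"]
  have "d v0 (\<omega> (Suc n)) \<le> d v0 x + d x (\<omega> (Suc n))"
    and "d x (\<omega> (Suc n)) \<le> d x v0 + d v0 (\<omega> (Suc n))"
    using d_triangle v0_in_verts xv(1) w(1) by blast+
  then show ?thesis
    using busemann_eq[OF \<omega> xv(1), of "Suc n"] xv w d_commute[OF xv(1) v0_in_verts] by simp
qed

end

section \<open>Sums over spheres and the dual Abel transform\<close>

lemma infsum_eq_sum:
  fixes f :: "'a \<Rightarrow> 'b :: {comm_monoid_add, t2_space}"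
  assumes "finite B" and "B \<subseteq> A" and "\<And>x. x \<in> A - B \<Longrightarrow> f x = 0"
  shows "infsum f A = sum f B"
proof -
  have "infsum f A = infsum f B" using assms by (intro infsum_cong_neutral) auto
  then show ?thesis using assms(1) by simp
qed

text \<open>This is the total weight that \<open>z\<close> receives when
  \<open>\<psi> \<bar>h\<bar>\<close> is summed over all integers \<open>h\<close> with
  \<open>\<bar>h\<bar> = z\<close>.\<close>

definition fold_weight :: "(int \<Rightarrow> complex) \<Rightarrow> int \<Rightarrow> complex" where
  "fold_weight \<psi> z = (if z < 0 then 0 else if z = 0 then \<psi> 0 else 2 * \<psi> z)"

lemma sum_abs_eq_fold_weight:
  assumes "\<bar>z\<bar> \<le> int N"
  shows "(\<Sum>h \<in> {- int N..int N}. \<psi> \<bar>h\<bar> * of_bool (z = \<bar>h\<bar>)) = fold_weight \<psi> z"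
proof (cases "0 \<le> z")
  case True
  then have "(\<Sum>h \<in> {- int N..int N}. \<psi> \<bar>h\<bar> * of_bool (z = \<bar>h\<bar>)) = (\<Sum>h \<in> {- z, z}. \<psi> z)"
    using assms by (intro sum.mono_neutral_cong_right) auto
  then show ?thesis using True by (auto simp: fold_weight_def)
next
  case False
  then show ?thesis by (auto simp: fold_weight_def intro!: sum.neutral)
qed

text \<open>For even \<open>g\<close> the weights at \<open>z\<close> and \<open>- z\<close> add up
  to \<open>2 * g z\<close>; average the sum with its reflection.\<close>

lemma sum_fold_weight_symmetric:
  assumes "\<And>z. z \<in> Z \<Longrightarrow> - z \<in> Z" and "\<And>h. g (- h) = g h"
  shows "sum (fold_weight g) Z = sum g Z"
proof -
  have "uminus ` Z = Z" using assms(1) by (force simp: image_iff)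
  then have "sum (fold_weight g) Z = sum (fold_weight g) (uminus ` Z)" by simp
  also have "\<dots> = (\<Sum>z\<in>Z. fold_weight g (- z))" by (simp add: sum.reindex)
  finally have "2 * sum (fold_weight g) Z = (\<Sum>z\<in>Z. fold_weight g z + fold_weight g (- z))"
    by (simp add: sum.distrib)
  also have "\<dots> = (\<Sum>z\<in>Z. 2 * g z)"
    using assms(2) by (intro sum.cong) (auto simp: fold_weight_def)
  finally show ?thesis by (simp add: sum_distrib_left[symmetric])
qed

text \<open>The integers \<open>2 * j - n\<close> run from \<open>- n\<close> to \<open>n\<close> in
  steps of two, so they have the parity of \<open>n\<close>.\<close>

lemma sum_opposite_parity:
  "(\<Sum>j\<le>n. f (2 * int j - int n)) =
    sum f {z. - int (Suc n) < z \<and> z < int (Suc n) \<and> even z \<noteq> even (Suc n)}"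
proof (rule sum.reindex_bij_witness[where i = "\<lambda>z. nat ((z + int n) div 2)" and j = "\<lambda>j. 2 * int j - int n"])
  fix z
  assume z: "z \<in> {z. - int (Suc n) < z \<and> z < int (Suc n) \<and> even z \<noteq> even (Suc n)}"
  then have "even (z + int n)" by auto
  then obtain t where t: "z + int n = 2 * t" by (rule evenE)
  then show "2 * int (nat ((z + int n) div 2)) - int n = z" "nat ((z + int n) div 2) \<in> {..n}"
    using z by auto
qed auto

text \<open>Here the integers run from \<open>1 - n\<close> to \<open>n - 1\<close> in steps of two,
  which exhausts their parity class strictly between the bounds.\<close>

lemma sum_same_parity:
  "(\<Sum>j\<in>{1..n}. f (2 * int j - 1 - int n)) =
    sum f {z. - int (Suc n) < z \<and> z < int (Suc n) \<and> even z = even (Suc n)}"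
proof (rule sum.reindex_bij_witness[where i = "\<lambda>z. nat ((z + 1 + int n) div 2)"
      and j = "\<lambda>j. 2 * int j - 1 - int n"])
  fix z
  assume z: "z \<in> {z. - int (Suc n) < z \<and> z < int (Suc n) \<and> even z = even (Suc n)}"
  then have "even (z + 1 + int n)" by auto
  then obtain t where t: "z + 1 + int n = 2 * t" by (rule evenE)
  then show "2 * int (nat ((z + 1 + int n) div 2)) - 1 - int n = z"
    "nat ((z + 1 + int n) div 2) \<in> {1..n}"
    using z by auto
qed auto

context branching_rooted_symmetric_graph begin

section \<open>Distribution of Busemann values on spheres\<close>

lemma busemann_ray:
  assumes "\<omega> \<in> \<Omega>"
  shows "busemann (\<omega> n) \<omega> = int n"
  using busemann_eq[OF assms \<Omega>D(1)[OF assms], of n "Suc n"] \<Omega>D(2,4)[OF assms] by simp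

lemma busemann_root: "\<omega> \<in> \<Omega> \<Longrightarrow> busemann v0 \<omega> = 0"
  using busemann_ray[of \<omega> 0] by (simp add: \<Omega>_def)

text \<open>
  Only the node of the ray on the sphere has a child polygon leading towards the end of the ray;
  all other children lie one horocycle further away from it.
\<close>

lemma sum_busemann_sphere_step:
  fixes \<phi> :: "int \<Rightarrow> complex"
  assumes \<omega>: "\<omega> \<in> \<Omega>"
  shows "(\<Sum>y \<in> sphere (Suc n). \<phi> (busemann y \<omega>)) =
    of_nat Q * (\<Sum>x \<in> sphere n. \<phi> (busemann x \<omega> - 1)) + \<phi> (int n + 1) + of_nat (k - 2) * \<phi> (int n)
    - (if n = 0 then 0 else of_nat (k - 1) * \<phi> (int n - 1))"
proof -
  \<comment> \<open>Level \<open>n + 2\<close> is the first that computes the Busemann function on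
    both spheres \<open>n\<close> and \<open>Suc n\<close>.\<close>
  define w where "w = \<omega> (n + 2)"
  let ?u = "\<omega> n"
  note u = \<Omega>D(1-3)[OF \<omega>, of n]
  have w: "w \<in> pverts G" "d v0 w = n + 2" using \<Omega>D[OF \<omega>] by (simp_all add: w_def)
  have uw: "d ?u w = 2" using \<Omega>D(4)[OF \<omega>, of n "n + 2"] by (simp add: w_def)
  have bus: "busemann x \<omega> = int n + 2 - int (d w x)" if "x \<in> pverts G" "d v0 x < n + 2" for x
    using busemann_eq[OF \<omega> that] d_commute[OF that(1) w(1)] by (simp add: w_def)
  define S where "S x P = (\<Sum>y \<in> \<Union>P - {x}. \<phi> (busemann y \<omega>))" for x P
  have away: "S x P = of_nat (k - 1) * \<phi> (busemann x \<omega> - 1)"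
    if x: "x \<in> sphere n" and P: "P \<in> child_polygons v0 x" and g: "gate P w = x" for x P
  proof -
    have "busemann y \<omega> = busemann x \<omega> - 1" if y: "y \<in> \<Union>P - {x}" for y
      using child_in_sphere(1)[OF x P y, THEN sphereD(1)] child_in_sphere(1)[OF x P y, THEN sphereD(2)]
        sphereD[OF x] bus[of x] bus[of y] d_gate[OF child_polygonsD(1)[OF P] w(1), of y] g y by simp
    then show ?thesis using card_polygon_minus[OF P] by (simp add: S_def)
  qed
  \<comment> \<open>One child is the gate for \<open>w\<close>, one step nearer to \<open>w\<close>
    than \<open>x\<close>; the other \<open>k - 2\<close> are as far from \<open>w\<close> as
    \<open>x\<close>.\<close>
  have towards: "S x P = \<phi> (busemann x \<omega> + 1) + of_nat (k - 2) * \<phi> (busemann x \<omega>)"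
    if x: "x \<in> sphere n" and P: "P \<in> child_polygons v0 x" and g: "gate P w \<noteq> x" for x P
  proof -
    let ?y = "gate P w"
    note P' = child_polygonsD[OF P]
    have y: "?y \<in> \<Union>P - {x}" using gate_in[OF P'(1) w(1)] g by blast
    have fin: "finite (\<Union>P - {x})" using finite_Union_polygon[OF P'(1)] by simp
    have dx: "d w x = Suc (d w ?y)" using d_gate[OF P'(1) w(1) P'(3)] g by simp
    have lvl: "z \<in> pverts G" "d v0 z < n + 2" if "z \<in> \<Union>P - {x}" for z
      using sphereD[OF child_in_sphere(1)[OF x P that]] by auto
    have bx: "busemann x \<omega> = int n + 2 - int (d w x)" using bus sphereD[OF x] by simp
    have by': "busemann ?y \<omega> = busemann x \<omega> + 1" using bus[OF lvl[OF y]] bx dx by simp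
    have bz: "busemann z \<omega> = busemann x \<omega>" if z: "z \<in> \<Union>P - {x} - {?y}" for z
      using bus[OF lvl[of z]] bx dx d_gate[OF P'(1) w(1), of z] z by simp
    have "S x P = \<phi> (busemann ?y \<omega>) + (\<Sum>z \<in> \<Union>P - {x} - {?y}. \<phi> (busemann z \<omega>))"
      unfolding S_def by (rule sum.remove[OF fin y])
    also have "\<dots> = \<phi> (busemann x \<omega> + 1) + of_nat (card (\<Union>P - {x} - {?y})) * \<phi> (busemann x \<omega>)"
      using by' bz by simp
    also have "card (\<Union>P - {x} - {?y}) = k - 2"
      using card_polygon_minus[OF P] fin y k_ge_2 by simp
    finally show ?thesis .
  qed
  \<comment> \<open>A child polygon leading towards \<open>w\<close> would put \<open>x\<close> on
    the geodesic from the root to \<open>w\<close>, where \<open>?u\<close> is the only vertex of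
    level \<open>n\<close>.\<close>
  have off: "(\<Sum>P \<in> child_polygons v0 x. S x P) = of_nat Q * \<phi> (busemann x \<omega> - 1)"
    if x: "x \<in> sphere n" "x \<noteq> ?u" for x
  proof -
    note xv = sphereD[OF x(1)]
    have "gate P w = x" if P: "P \<in> child_polygons v0 x" for P
    proof (rule ccontr)
      assume "gate P w \<noteq> x"
      then have "d v0 x + d x w = d v0 w"
        using geodesic_through_child_polygon[OF v0_in_verts w(1) xv(1) P] by blast
      then have "x = ?u"
        using geodesic_vertex_unique[OF v0_in_verts w(1) xv(1) _ u(1)] u(2) uw w(2) xv(2) by simp
      then show False using x(2) by blast
    qed
    then have "(\<Sum>P \<in> child_polygons v0 x. S x P)
        = (\<Sum>P \<in> child_polygons v0 x. of_nat (k - 1) * \<phi> (busemann x \<omega> - 1))"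
      using away[OF x(1)] by (intro sum.cong) auto
    moreover have "x \<noteq> v0" using xv u x(2) sphere_0 by auto
    ultimately show ?thesis using card_child_polygons[OF xv(1)] by (simp add: Q_def)
  qed
  have on: "(\<Sum>P \<in> child_polygons v0 ?u. S ?u P) = of_nat Q * \<phi> (int n - 1)
    + \<phi> (int n + 1) + of_nat (k - 2) * \<phi> (int n) - (if n = 0 then 0 else of_nat (k - 1) * \<phi> (int n - 1))"
  proof -
    have "w \<noteq> ?u" using uw u(1) by auto
    then obtain P0 where P0: "P0 \<in> polygons_at ?u" "gate P0 w \<noteq> ?u"
      using ex1_entry_polygon[OF w(1) u(1)] by blast
    have c: "P0 \<in> child_polygons v0 ?u"
      using child_polygon_of_geodesic[OF v0_in_verts w(1) u(1) _ P0] u(2) uw w(2) by simp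
    have others: "gate P w = ?u" if "P \<in> child_polygons v0 ?u - {P0}" for P
      using that entry_polygon_unique[OF w(1) u(1) P0, of P] child_polygonsD(2) by blast
    note fin = finite_child_polygons[OF u(1)]
    have card0: "card (child_polygons v0 ?u - {P0}) = (if n = 0 then r else r - 1) - 1"
      using card_child_polygons[OF u(1)] c fin u d_eq_0_iff[OF v0_in_verts u(1)] by auto
    have "(\<Sum>P \<in> child_polygons v0 ?u. S ?u P)
        = S ?u P0 + (\<Sum>P \<in> child_polygons v0 ?u - {P0}. S ?u P)"
      by (rule sum.remove[OF fin c])
    also have "(\<Sum>P \<in> child_polygons v0 ?u - {P0}. S ?u P)
        = (\<Sum>P \<in> child_polygons v0 ?u - {P0}. of_nat (k - 1) * \<phi> (int n - 1))"
      using away[OF u(3)] others busemann_ray[OF \<omega>] by (intro sum.cong) auto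
    also have "S ?u P0 = \<phi> (int n + 1) + of_nat (k - 2) * \<phi> (int n)"
      using towards[OF u(3) c P0(2)] busemann_ray[OF \<omega>] by simp
    finally have sum_S: "(\<Sum>P \<in> child_polygons v0 ?u. S ?u P) = \<phi> (int n + 1) + of_nat (k - 2) * \<phi> (int n)
        + of_nat ((if n = 0 then r else r - 1) - 1) * of_nat (k - 1) * \<phi> (int n - 1)"
      using card0 by (simp add: mult.assoc)
    \<comment> \<open>The root has \<open>r\<close> child polygons, so \<open>r - 1\<close> remain
      after removing \<open>P0\<close> and give the full \<open>Q\<close>. Elsewhere only
      \<open>r - 2\<close> remain, which causes the correction term.\<close>
    have coeff: "of_nat ((if n = 0 then r else r - 1) - 1) * of_nat (k - 1)
        = (of_nat Q - (if n = 0 then 0 else of_nat (k - 1)) :: complex)"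
    proof -
      have "r - 1 - 1 = r - 2" by simp
      moreover have "(of_nat Q :: complex) = of_nat (r - 1) * of_nat (k - 1)" by (simp add: Q_def)
      moreover have "(of_nat Q :: complex) = of_nat (r - 2) * of_nat (k - 1) + of_nat (k - 1)"
        by (simp only: Q_eq of_nat_add of_nat_mult)
      ultimately show ?thesis by (cases "n = 0") (simp_all add: eq_diff_eq)
    qed
    show ?thesis unfolding sum_S coeff by (simp add: algebra_simps)
  qed
  have "(\<Sum>y \<in> sphere (Suc n). \<phi> (busemann y \<omega>)) = (\<Sum>x \<in> sphere n. \<Sum>P \<in> child_polygons v0 x. S x P)"
    unfolding S_def by (rule sum_sphere_Suc)
  also have "\<dots> = (\<Sum>P \<in> child_polygons v0 ?u. S ?u P)
      + (\<Sum>x \<in> sphere n - {?u}. \<Sum>P \<in> child_polygons v0 x. S x P)"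
    by (rule sum.remove[OF finite_sphere u(3)])
  also have "(\<Sum>x \<in> sphere n - {?u}. \<Sum>P \<in> child_polygons v0 x. S x P)
      = (\<Sum>x \<in> sphere n - {?u}. of_nat Q * \<phi> (busemann x \<omega> - 1))"
    using off by (intro sum.cong) auto
  also have "\<dots> = of_nat Q * ((\<Sum>x \<in> sphere n. \<phi> (busemann x \<omega> - 1)) - \<phi> (int n - 1))"
    using sum.remove[OF finite_sphere u(3), of "\<lambda>x. \<phi> (busemann x \<omega> - 1)"] busemann_ray[OF \<omega>]
    by (simp add: sum_distrib_left[symmetric])
  finally show ?thesis unfolding on by (simp add: algebra_simps)
qed

text \<open>The terms sort the vertices by where their geodesic from the root leaves the ray: never;
  at the root (\<open>Q ^ Suc n\<close> vertices); after node \<open>j\<close>, to a vertex off the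
  ray of the polygon joining it to the next node; or at node \<open>j > 0\<close> through another
  polygon. Each later step multiplies the count by \<open>Q\<close> and lowers the Busemann value by
  one. The proof unrolls the one-step recursion with the shifted function
  \<open>\<phi> (z - 1)\<close>.\<close>

lemma sum_busemann_sphere_Suc:
  fixes \<phi> :: "int \<Rightarrow> complex"
  assumes \<omega>: "\<omega> \<in> \<Omega>"
  shows "(\<Sum>x \<in> sphere (Suc n). \<phi> (busemann x \<omega>)) =
    \<phi> (int (Suc n)) + of_nat Q ^ Suc n * \<phi> (- int (Suc n))
    + of_nat (k - 2) * (\<Sum>j\<le>n. of_nat Q ^ (n - j) * \<phi> (2 * int j - int n))
    + of_nat ((r - 2) * (k - 1)) * (\<Sum>j\<in>{1..n}. of_nat Q ^ (n - j) * \<phi> (2 * int j - 1 - int n))"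
proof (induction n arbitrary: \<phi>)
  case 0
  show ?case using sum_busemann_sphere_step[OF \<omega>, of \<phi> 0]
    by (simp add: sphere_0 busemann_root[OF \<omega>])
next
  case (Suc n)
  have 1: "(\<Sum>j\<le>Suc n. of_nat Q ^ (Suc n - j) * \<phi> (2 * int j - int (Suc n)))
      = \<phi> (int (Suc n)) + of_nat Q * (\<Sum>j\<le>n. of_nat Q ^ (n - j) * \<phi> (2 * int j - int n - 1))"
    by (simp add: sum_distrib_left Suc_diff_le algebra_simps)
  have 2: "(\<Sum>j\<in>{1..Suc n}. of_nat Q ^ (Suc n - j) * \<phi> (2 * int j - 1 - int (Suc n)))
      = \<phi> (int n) + of_nat Q * (\<Sum>j\<in>{1..n}. of_nat Q ^ (n - j) * \<phi> (2 * int j - 1 - int n - 1))"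
    by (simp add: sum_distrib_left Suc_diff_le algebra_simps)
  \<comment> \<open>The coefficient of \<open>\<phi> (int n)\<close> is \<open>Q\<close> from the
    induction hypothesis minus \<open>k - 1\<close> from the recursion; this supplies the new last
    summand of the second sum.\<close>
  have Q: "(of_nat Q :: complex) = of_nat ((r - 2) * (k - 1)) + of_nat (k - 1)"
  proof -
    show ?thesis by (simp only: Q_eq of_nat_add)
  qed
  have "(\<Sum>x \<in> sphere (Suc (Suc n)). \<phi> (busemann x \<omega>)) =
    of_nat Q * (\<Sum>x \<in> sphere (Suc n). \<phi> (busemann x \<omega> - 1)) + \<phi> (int (Suc n) + 1)
    + of_nat (k - 2) * \<phi> (int (Suc n)) - of_nat (k - 1) * \<phi> (int n)"
    using sum_busemann_sphere_step[OF \<omega>, of \<phi> "Suc n"] by simp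
  also have "(\<Sum>x \<in> sphere (Suc n). \<phi> (busemann x \<omega> - 1)) =
    \<phi> (int n) + of_nat Q ^ Suc n * \<phi> (- int (Suc (Suc n)))
    + of_nat (k - 2) * (\<Sum>j\<le>n. of_nat Q ^ (n - j) * \<phi> (2 * int j - int n - 1))
    + of_nat ((r - 2) * (k - 1)) * (\<Sum>j\<in>{1..n}. of_nat Q ^ (n - j) * \<phi> (2 * int j - 1 - int n - 1))"
    using Suc[of "\<lambda>z. \<phi> (z - 1)"] by (simp add: algebra_simps)
  finally show ?case unfolding 1 2 using Q
    by (simp add: algebra_simps)
qed

text \<open>The closed form does not mention the ray. This makes the Abel transform well
  defined.\<close>

lemma sum_busemann_sphere_indep:
  fixes \<phi> :: "int \<Rightarrow> complex"
  assumes "\<omega> \<in> \<Omega>" and "\<omega>' \<in> \<Omega>"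
  shows "(\<Sum>x \<in> sphere n. \<phi> (busemann x \<omega>)) = (\<Sum>x \<in> sphere n. \<phi> (busemann x \<omega>'))"
  by (cases n) (simp_all only: sum_busemann_sphere_Suc[OF assms(1)] sum_busemann_sphere_Suc[OF assms(2)],
      simp add: sphere_0 busemann_root assms)

section \<open>Radial functions and the Abel transform\<close>

lemma radial_value_eq:
  assumes "radial f" and "x \<in> sphere n"
  shows "radial_value f n = f x"
  unfolding radial_value_def using assms by (intro the_equality) (auto simp: radial_def sphere_def)

lemma radial_fin_supp_bounded:
  assumes "f \<in> radial_fin_supp"
  obtains N where "\<forall>x \<in> pverts G. N < d v0 x \<longrightarrow> f x = 0"
proof -
  have fin: "finite (d v0 ` {x \<in> pverts G. f x \<noteq> 0})" using assms by (simp add: radial_fin_supp_def)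
  have "d v0 x \<le> Max (d v0 ` {x \<in> pverts G. f x \<noteq> 0})" if "x \<in> pverts G" "f x \<noteq> 0" for x
    using that fin by (intro Max_ge) auto
  then show ?thesis using that by (meson leD)
qed

lemma radial_value_eq_0:
  assumes "radial f" and "\<forall>x \<in> pverts G. N < d v0 x \<longrightarrow> f x = 0" and "N < n"
  shows "radial_value f n = 0"
proof -
  \<comment> \<open>A nonempty sphere is what makes the definite description in
    \<open>radial_value\<close> determinate.\<close>
  have "sphere n \<noteq> {}" using \<delta>_pos[of n] by (auto simp: \<delta>_def)
  then obtain x where x: "x \<in> sphere n" by blast
  then show ?thesis using radial_value_eq[OF assms(1) x] assms(2,3) sphereD[OF x] by simp
qed

text \<open>Sort the horocycle by spheres, on each of which \<open>f\<close> is constant. The number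
  of vertices common to a horocycle and a sphere is the same for all rays.\<close>

lemma abel_eq:
  assumes f: "f \<in> radial_fin_supp" and \<omega>: "\<omega> \<in> \<Omega>"
    and N: "\<forall>x \<in> pverts G. N < d v0 x \<longrightarrow> f x = 0"
  shows "abel f h = of_real (real Q powr (real_of_int h / 2)) *
    (\<Sum>n\<le>N. radial_value f n * (\<Sum>x \<in> sphere n. of_bool (busemann x \<omega> = h)))"
proof -
  have rad: "radial f" using f by (simp add: radial_fin_supp_def)
  have hor: "(\<Sum>\<^sub>\<infinity>x \<in> horocycle \<omega>' h. f x)
      = (\<Sum>n\<le>N. radial_value f n * (\<Sum>x \<in> sphere n. of_bool (busemann x \<omega> = h)))"
    if \<omega>': "\<omega>' \<in> \<Omega>" for \<omega>'
  proof -
    have un: "x \<in> pverts G \<and> d v0 x \<le> N \<longleftrightarrow> x \<in> (\<Union>n\<le>N. sphere n)" for x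
      by (auto dest: sphereD intro: sphereI)
    have "(\<Sum>\<^sub>\<infinity>x \<in> horocycle \<omega>' h. f x) = sum f {x \<in> \<Union>n\<le>N. sphere n. busemann x \<omega>' = h}"
    proof (rule infsum_eq_sum)
      show "{x \<in> \<Union>n\<le>N. sphere n. busemann x \<omega>' = h} \<subseteq> horocycle \<omega>' h"
        by (auto simp: horocycle_def dest: sphereD)
      show "f x = 0" if "x \<in> horocycle \<omega>' h - {x \<in> \<Union>n\<le>N. sphere n. busemann x \<omega>' = h}" for x
      proof -
        have x: "x \<in> pverts G" "\<not> (x \<in> (\<Union>n\<le>N. sphere n))"
          using that by (auto simp: horocycle_def)
        then show ?thesis using N un[of x] by (meson not_le)
      qed
    qed (use finite_sphere in simp)
    also have "\<dots> = (\<Sum>x \<in> (\<Union>n\<le>N. sphere n). if busemann x \<omega>' = h then f x else 0)"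
      by (intro sum.inter_filter) (use finite_sphere in simp)
    also have "\<dots> = (\<Sum>n\<le>N. \<Sum>x \<in> sphere n. if busemann x \<omega>' = h then f x else 0)"
      by (intro sum.UNION_disjoint) (use finite_sphere in \<open>auto dest: sphereD\<close>)
    also have "\<dots> = (\<Sum>n\<le>N. radial_value f n * (\<Sum>x \<in> sphere n. of_bool (busemann x \<omega>' = h)))"
      unfolding sum_distrib_left by (intro sum.cong refl) (simp add: radial_value_eq[OF rad])
    also have "\<dots> = (\<Sum>n\<le>N. radial_value f n * (\<Sum>x \<in> sphere n. of_bool (busemann x \<omega> = h)))"
      using sum_busemann_sphere_indep[OF \<omega>' \<omega>, of "\<lambda>z. of_bool (z = h)"] by simp
    finally show ?thesis .
  qed
  show ?thesis
    unfolding abel_def Q_def[symmetric] using \<omega> hor by (intro the_equality) auto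
qed

text \<open>Exchange the sums so that the one over \<open>h\<close> becomes innermost. For a fixed
  vertex it collapses to the folded weight of its Busemann value.\<close>

lemma sum_weighted_abel:
  fixes g :: "int \<Rightarrow> complex"
  assumes f: "f \<in> radial_fin_supp" and \<omega>: "\<omega> \<in> \<Omega>"
    and N: "\<forall>x \<in> pverts G. N < d v0 x \<longrightarrow> f x = 0"
  defines "\<psi> \<equiv> \<lambda>z. g z * of_real (real Q powr (real_of_int z / 2))"
  shows "(\<Sum>\<^sub>\<infinity>h. g \<bar>h\<bar> * abel f \<bar>h\<bar>) =
    (\<Sum>n\<le>N. radial_value f n * (\<Sum>x \<in> sphere n. fold_weight \<psi> (busemann x \<omega>)))"
proof -
  note ab = abel_eq[OF f \<omega> N]
  have "(\<Sum>\<^sub>\<infinity>h. g \<bar>h\<bar> * abel f \<bar>h\<bar>) = (\<Sum>h \<in> {- int N..int N}. g \<bar>h\<bar> * abel f \<bar>h\<bar>)"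
  proof (rule infsum_eq_sum)
    fix h :: int
    assume h: "h \<in> UNIV - {- int N..int N}"
    \<comment> \<open>Busemann values on spheres up to radius \<open>N\<close> are at most
      \<open>N\<close> in absolute value, so horocycles further out contribute nothing.\<close>
    have "busemann x \<omega> \<noteq> \<bar>h\<bar>" if "x \<in> sphere n" "n \<le> N" for n x
      using abs_busemann_le[OF \<omega> that(1)] that(2) h by auto
    then have "(\<Sum>n\<le>N. radial_value f n * (\<Sum>x \<in> sphere n. of_bool (busemann x \<omega> = \<bar>h\<bar>))) = 0"
      by (intro sum.neutral) simp
    then show "g \<bar>h\<bar> * abel f \<bar>h\<bar> = 0" using ab[where h = "\<bar>h\<bar>"] by simp
  qed auto
  also have "\<dots> = (\<Sum>h \<in> {- int N..int N}. \<Sum>n\<le>N. radial_value f n *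
      (\<Sum>x \<in> sphere n. \<psi> \<bar>h\<bar> * of_bool (busemann x \<omega> = \<bar>h\<bar>)))"
    unfolding ab by (simp add: \<psi>_def sum_distrib_left mult_ac)
  also have "\<dots> = (\<Sum>n\<le>N. radial_value f n *
      (\<Sum>h \<in> {- int N..int N}. \<Sum>x \<in> sphere n. \<psi> \<bar>h\<bar> * of_bool (busemann x \<omega> = \<bar>h\<bar>)))"
    unfolding sum_distrib_left by (rule sum.swap)
  also have "\<dots> = (\<Sum>n\<le>N. radial_value f n *
      (\<Sum>x \<in> sphere n. \<Sum>h \<in> {- int N..int N}. \<psi> \<bar>h\<bar> * of_bool (busemann x \<omega> = \<bar>h\<bar>)))"
    by (intro sum.cong refl arg_cong2[where f = "(*)"] sum.swap)
  also have "\<dots> = (\<Sum>n\<le>N. radial_value f n * (\<Sum>x \<in> sphere n. fold_weight \<psi> (busemann x \<omega>)))"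
  proof (intro sum.cong refl arg_cong2[where f = "(*)"])
    fix n x
    assume "n \<in> {..N}" and "x \<in> sphere n"
    then have "\<bar>busemann x \<omega>\<bar> \<le> int N" using abs_busemann_le[OF \<omega>] by fastforce
    then show "(\<Sum>h \<in> {- int N..int N}. \<psi> \<bar>h\<bar> * of_bool (busemann x \<omega> = \<bar>h\<bar>))
        = fold_weight \<psi> (busemann x \<omega>)"
      by (rule sum_abs_eq_fold_weight)
  qed
  finally show ?thesis .
qed

section \<open>The dual Abel transform\<close>

text \<open>Sphere means satisfy the defining identity by \<open>sum_weighted_abel\<close>; testing
  with indicators of spheres shows that nothing else does.\<close>

lemma dual_abel_eq:
  fixes g :: "int \<Rightarrow> complex"
  assumes \<omega>: "\<omega> \<in> \<Omega>"
  defines "\<psi> \<equiv> \<lambda>z. g z * of_real (real Q powr (real_of_int z / 2))"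
  shows "dual_abel g n = (\<Sum>x \<in> sphere n. fold_weight \<psi> (busemann x \<omega>)) / of_nat (\<delta> n)"
proof -
  define B where "B n = (\<Sum>x \<in> sphere n. fold_weight \<psi> (busemann x \<omega>))" for n
  have lhs: "(\<Sum>\<^sub>\<infinity>n. a n * radial_value f n * of_nat (\<delta> n))
      = (\<Sum>n\<le>N. a n * radial_value f n * of_nat (\<delta> n))"
    if "f \<in> radial_fin_supp" "\<forall>x \<in> pverts G. N < d v0 x \<longrightarrow> f x = 0" for a f N
    using that radial_value_eq_0[of f N] by (intro infsum_eq_sum) (auto simp: radial_fin_supp_def)
  note rhs = sum_weighted_abel[where g = g, OF _ \<omega>, folded \<psi>_def, folded B_def]
  have "dual_abel g = (\<lambda>n. B n / of_nat (\<delta> n))"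
    unfolding dual_abel_def
  proof (rule the_equality, rule ballI)
    fix f
    assume f: "f \<in> radial_fin_supp"
    obtain N where N: "\<forall>x \<in> pverts G. N < d v0 x \<longrightarrow> f x = 0"
      using radial_fin_supp_bounded[OF f] .
    show "(\<Sum>\<^sub>\<infinity>n. B n / of_nat (\<delta> n) * radial_value f n * of_nat (\<delta> n)) = (\<Sum>\<^sub>\<infinity>h. g \<bar>h\<bar> * abel f \<bar>h\<bar>)"
      unfolding lhs[OF f N] rhs[OF f N] using \<delta>_pos by (intro sum.cong refl) (simp add: less_imp_neq[symmetric])
  next
    fix a
    assume a: "\<forall>f \<in> radial_fin_supp. (\<Sum>\<^sub>\<infinity>n. a n * radial_value f n * of_nat (\<delta> n))
      = (\<Sum>\<^sub>\<infinity>h. g \<bar>h\<bar> * abel f \<bar>h\<bar>)"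
    have "a n = B n / of_nat (\<delta> n)" for n
    proof -
      define f where "f x = (of_bool (x \<in> sphere n) :: complex)" for x
      have rad: "radial f" by (auto simp: radial_def f_def sphere_def)
      have "{x \<in> pverts G. f x \<noteq> 0} = sphere n" by (auto simp: f_def dest: sphereD)
      then have f: "f \<in> radial_fin_supp" using rad finite_sphere by (simp add: radial_fin_supp_def)
      have N: "\<forall>x \<in> pverts G. n < d v0 x \<longrightarrow> f x = 0"
        by (auto simp: f_def dest: sphereD)
      have val: "radial_value f i = of_bool (i = n)" for i
      proof -
        have "sphere i \<noteq> {}" using \<delta>_pos[of i] by (auto simp: \<delta>_def)
        then obtain x where x: "x \<in> sphere i" by blast
        then show ?thesis using radial_value_eq[OF rad x] by (auto simp: f_def sphere_def)
      qed
      have sel: "(\<Sum>i\<le>n. F i * of_bool (i = n)) = F n" for F :: "nat \<Rightarrow> complex"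
      proof -
        have "(\<Sum>i\<le>n. F i * of_bool (i = n)) = (\<Sum>i\<in>{n}. F i)"
          by (intro sum.mono_neutral_cong_right) auto
        then show ?thesis by simp
      qed
      have "(\<Sum>i\<le>n. a i * of_bool (i = n) * of_nat (\<delta> i)) = (\<Sum>i\<le>n. of_bool (i = n) * B i)"
        using bspec[OF a f] unfolding lhs[OF f N] rhs[OF f N] unfolding val .
      then have "a n * of_nat (\<delta> n) = B n"
        using sel[of "\<lambda>i. a i * of_nat (\<delta> i)"] sel[of B] by (simp add: mult_ac)
      then show ?thesis using \<delta>_pos[of n] by (simp add: field_simps)
    qed
    then show "a = (\<lambda>n. B n / of_nat (\<delta> n))" by blast
  qed
  then show ?thesis by (simp add: B_def)
qed

lemma dual_abel_0: "dual_abel g 0 = g 0"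
proof -
  obtain \<omega> where \<omega>: "\<omega> \<in> \<Omega>" using \<Omega>_nonempty by blast
  show ?thesis
    using dual_abel_eq[OF \<omega>, of g 0] Q_pos
    by (simp add: sphere_0 busemann_root[OF \<omega>] \<delta>_0 fold_weight_def)
qed

text \<open>The count \<open>Q ^ (n - j)\<close> and the weight \<open>Q\<close> to the half
  Busemann value multiply to a power independent of \<open>j\<close>. What remains are folded sums
  over symmetric sets of integers, where evenness of \<open>g\<close> removes the folding.\<close>

lemma dual_abel_Suc:
  fixes g :: "int \<Rightarrow> complex"
  assumes even_g: "\<And>h. g (- h) = g h"
  shows "dual_abel g (Suc n) =
    2 * ((of_nat r - 1) / of_nat r) * of_real (real Q powr (- real (Suc n) / 2)) * g (int (Suc n))
    + of_nat (k - 2) * ((of_nat r - 1) / of_nat r) * of_real (real Q powr (- (real (Suc n) + 1) / 2)) *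
        (\<Sum>j | - int (Suc n) < j \<and> j < int (Suc n) \<and> even j \<noteq> even (Suc n). g j)
    + ((of_nat r - 2) / of_nat r) * of_real (real Q powr (- real (Suc n) / 2)) *
        (\<Sum>j | - int (Suc n) < j \<and> j < int (Suc n) \<and> even j = even (Suc n). g j)"
    (is "_ = _ + _ * ?X + _ * ?Y")
proof -
  obtain \<omega> where \<omega>: "\<omega> \<in> \<Omega>" using \<Omega>_nonempty by blast
  define p where "p e = (of_real (real Q powr e) :: complex)" for e
  define \<psi> where "\<psi> z = g z * p (real_of_int z / 2)" for z
  have p_add: "p (a + b) = p a * p b" for a b by (simp add: p_def powr_add)
  have p_0: "p 0 = 1" using Q_pos by (simp add: p_def)
  have p_nat: "of_nat Q ^ m = p (real m)" for m using Q_pos by (simp add: p_def powr_realpow)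
  have fold: "fold_weight \<psi> z = fold_weight g z * p (real_of_int z / 2)" for z
    by (simp add: fold_weight_def \<psi>_def p_0)
  have "(\<Sum>j\<le>n. of_nat Q ^ (n - j) * fold_weight \<psi> (2 * int j - int n))
      = (\<Sum>j\<le>n. p (real n / 2) * fold_weight g (2 * int j - int n))"
  proof (intro sum.cong refl)
    fix j
    assume "j \<in> {..n}"
    then have "real n / 2 = real (n - j) + real_of_int (2 * int j - int n) / 2"
      by (simp add: of_nat_diff field_simps)
    then show "of_nat Q ^ (n - j) * fold_weight \<psi> (2 * int j - int n)
        = p (real n / 2) * fold_weight g (2 * int j - int n)"
      by (simp only: fold p_nat p_add mult_ac)
  qed
  also have "\<dots> = p (real n / 2) * sum (fold_weight g)
      {z. - int (Suc n) < z \<and> z < int (Suc n) \<and> even z \<noteq> even (Suc n)}"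
    by (simp only: sum_distrib_left[symmetric] sum_opposite_parity[of "fold_weight g"])
  also have "\<dots> = p (real n / 2) * ?X"
    using even_g by (subst sum_fold_weight_symmetric) auto
  finally have X: "(\<Sum>j\<le>n. of_nat Q ^ (n - j) * fold_weight \<psi> (2 * int j - int n)) = p (real n / 2) * ?X" .
  have "(\<Sum>j\<in>{1..n}. of_nat Q ^ (n - j) * fold_weight \<psi> (2 * int j - 1 - int n))
      = (\<Sum>j\<in>{1..n}. p ((real n - 1) / 2) * fold_weight g (2 * int j - 1 - int n))"
  proof (intro sum.cong refl)
    fix j
    assume "j \<in> {1..n}"
    then have "(real n - 1) / 2 = real (n - j) + real_of_int (2 * int j - 1 - int n) / 2"
      by (simp add: of_nat_diff field_simps)
    then show "of_nat Q ^ (n - j) * fold_weight \<psi> (2 * int j - 1 - int n)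
        = p ((real n - 1) / 2) * fold_weight g (2 * int j - 1 - int n)"
      by (simp only: fold p_nat p_add mult_ac)
  qed
  also have "\<dots> = p ((real n - 1) / 2) * sum (fold_weight g)
      {z. - int (Suc n) < z \<and> z < int (Suc n) \<and> even z = even (Suc n)}"
    by (simp only: sum_distrib_left[symmetric] sum_same_parity[of "fold_weight g"])
  also have "\<dots> = p ((real n - 1) / 2) * ?Y"
    using even_g by (subst sum_fold_weight_symmetric) auto
  finally have Y: "(\<Sum>j\<in>{1..n}. of_nat Q ^ (n - j) * fold_weight \<psi> (2 * int j - 1 - int n))
    = p ((real n - 1) / 2) * ?Y" .
  have "dual_abel g (Suc n) = (\<Sum>x \<in> sphere (Suc n). fold_weight \<psi> (busemann x \<omega>)) / of_nat (\<delta> (Suc n))"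
    unfolding \<psi>_def[abs_def] p_def by (rule dual_abel_eq[OF \<omega>])
  \<comment> \<open>The extreme value \<open>int (Suc n)\<close> is positive and counts twice, while
    \<open>- int (Suc n)\<close> has folded weight 0.\<close>
  also have "(\<Sum>x \<in> sphere (Suc n). fold_weight \<psi> (busemann x \<omega>)) =
      2 * g (int (Suc n)) * p (real (Suc n) / 2) + of_nat (k - 2) * (p (real n / 2) * ?X)
      + of_nat ((r - 2) * (k - 1)) * (p ((real n - 1) / 2) * ?Y)"
    unfolding sum_busemann_sphere_Suc[OF \<omega>] X Y by (simp add: fold_weight_def \<psi>_def)
  finally have dual: "dual_abel g (Suc n) = \<dots> / of_nat (\<delta> (Suc n))" .
  have nz: "(of_nat r :: complex) \<noteq> 0" "(of_nat (k - 1) :: complex) \<noteq> 0" "p (real n) \<noteq> 0"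
    using r_ge_2 k_ge_2 Q_pos by (simp_all add: p_def)
  have Q': "p 1 = (of_nat r - 1) * of_nat (k - 1)"
    using r_ge_2 p_nat[of 1] by (simp add: Q_def of_nat_diff)
  have r2: "(of_nat ((r - 2) * (k - 1)) :: complex) = (of_nat r - 2) * of_nat (k - 1)"
    using r_ge_2 by (simp add: of_nat_diff)
  \<comment> \<open>The exponents are split so that \<open>p (real n)\<close> cancels against the
    sphere cardinality. In the first two cases \<open>p 1\<close> leaves the factor
    \<open>r - 1\<close>; in the third, \<open>r - 2\<close> comes from \<open>r2\<close>.\<close>
  have e1: "p (real (Suc n) / 2) = p (- real (Suc n) / 2) * p 1 * p (real n)"
    and e2: "p (real n / 2) = p (- (real (Suc n) + 1) / 2) * p 1 * p (real n)"
    and e3: "p ((real n - 1) / 2) = p (- real (Suc n) / 2) * p (real n)"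
    unfolding p_add[symmetric] by (simp_all add: field_simps)
  have \<delta>: "of_nat (\<delta> (Suc n)) = of_nat r * of_nat (k - 1) * p (real n)"
    by (simp add: \<delta>_Suc p_nat[symmetric])
  show ?thesis
    unfolding dual \<delta> e1 e2 e3 r2 Q' p_def[symmetric]
    using nz by (simp add: field_simps)
qed

end

theorem theorem3p7:
  fixes G :: "'v pair_pre_digraph" and k r Q \<sigma> :: nat and v0 :: 'v
    and g :: "int \<Rightarrow> complex"
  assumes "2 \<le> k" and "2 \<le> r"
    and "rooted_symmetric_graph G k r v0"
    and "Q = (r - 1) * (k - 1)" and "\<sigma> = k - 2"
    and "\<And>h. g (- h) = g h"
  shows "rooted_symmetric_graph.dual_abel G k r v0 g 0 = g 0 \<and>
    (\<forall>n>0. rooted_symmetric_graph.dual_abel G k r v0 g n =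
      2 * ((of_nat r - 1) / of_nat r) * of_real (real Q powr (- real n / 2)) * g (int n)
      + of_nat \<sigma> * ((of_nat r - 1) / of_nat r) * of_real (real Q powr (- (real n + 1) / 2)) *
          (\<Sum>j | - int n < j \<and> j < int n \<and> even j \<noteq> even n. g j)
      + ((of_nat r - 2) / of_nat r) * of_real (real Q powr (- real n / 2)) *
          (\<Sum>j | - int n < j \<and> j < int n \<and> even j = even n. g j))"
proof -
  interpret rooted_symmetric_graph G k r v0 by fact
  interpret B: branching_rooted_symmetric_graph G k r v0
    by unfold_locales (fact assms)+
  have Q: "Q = B.Q" by (simp add: assms(4) B.Q_def)
  show ?thesis
    unfolding Q assms(5)
  proof (intro conjI allI impI)
    fix n :: nat
    assume "0 < n"
    then obtain m where "n = Suc m" using gr0_implies_Suc by blast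
    then show "dual_abel g n =
      2 * ((of_nat r - 1) / of_nat r) * of_real (real B.Q powr (- real n / 2)) * g (int n)
      + of_nat (k - 2) * ((of_nat r - 1) / of_nat r) * of_real (real B.Q powr (- (real n + 1) / 2)) *
          (\<Sum>j | - int n < j \<and> j < int n \<and> even j \<noteq> even n. g j)
      + ((of_nat r - 2) / of_nat r) * of_real (real B.Q powr (- real n / 2)) *
          (\<Sum>j | - int n < j \<and> j < int n \<and> even j = even n. g j)"
      using B.dual_abel_Suc[of g m, OF assms(6)] by (simp only:)
  qed (rule B.dual_abel_0)
qed

end
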